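(* Let $q\geq 2$ and $d\geq 1$ be integers. For any $d$ masses $\mu_1,\ldots,\mu_d$ on $\mathbb{C}^d$ and any integers $m_1,\ldots,m_d>0$, there exists a complex hyperplane $H_{\mathbb{C}}\subset\mathbb{C}^d$ whose surrounding regular $q$-sectors $\{\mathcal{S}_{q,\lambda}\}_{\lambda\in S^1}$ satisfy $$c_{j,m_j}=c_{j,-m_j}=0 \quad\text{for each } 1\leq j\leq d,$$ where $c_{j,m}=\int_{S^1}\mu_j(\mathcal{S}_{q,\lambda})\,\lambda^{-m}\,d\lambda\in\mathbb{C}$ $(m\in\mathbb{Z})$ are the Fourier coefficients of the function $S^1\to\mathbb{R}$, $\lambda\mapsto\mu_j(\mathcal{S}_{q,\lambda})$.
   Context: A mass on $\mathbb{C}^d$ (identified with $\mathbb{R}^{2d}$) is a finite measure that is absolutely continuous with respect to Lebesgue measure. $S^1$ denotes the unit complex numbers, and $d\lambda$ is the normalized (total mass $1$) rotation-invariant measure on $S^1$. A complex hyperplane in $\mathbb{C}^d$ is a complex affine subspace of complex codimension $1$ (a point if $d=1$); it can be written as $H_{\mathbb{C}}=\{\mathbf{u}\in\mathbb{C}^d\mid \langle \mathbf{u},\mathbf{a}\rangle_{\mathbb{C}}+\bar b=0\}$ with $\mathbf{a}\in\mathbb{C}^d\setminus\{\mathbf{0}\}$, $b\in\mathbb{C}$, $\|\mathbf{a}\|^2+|b|^2=1$, where $\langle\mathbf{u},\mathbf{a}\rangle_{\mathbb{C}}=\sum_{i=1}^d u_i\bar a_i$. A complex regular $q$-fan centered about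 $H_{\mathbb{C}}$ is the union of $q$ half-hyperplanes (halves of real hyperplanes) with common boundary $H_{\mathbb{C}}$ whose successive dihedral angles all equal $2\pi/q$; the resulting closed regions are called regular $q$-sectors. The regular $q$-sectors of all complex regular $q$-fans centered about $H_{\mathbb{C}}$ are parametrized by $\lambda\in S^1$ as $$\mathcal{S}_{q,\lambda}=\{\mathbf{u}\in\mathbb{C}^d\mid \langle\mathbf{u},\mathbf{a}\rangle_{\mathbb{C}}+\bar b=\lambda v \text{ for some } v\in\mathbb{C} \text{ with } v=0 \text{ or } |\arg v|\leq \pi/q\}.$$ Replacing $(\mathbf{a},b)$ by another unit vector defining the same hyperplane only replaces this family by a rotated parametrization $\lambda\mapsto\lambda\lambda_0$ with $\lambda_0 \in S^1$, so the vanishing of a Fourier coefficient depends only on $H_{\mathbb{C}}$. *)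

theory Defs
  imports "HOL-Analysis.Analysis"
begin

definition mass :: "'a::euclidean_space measure \<Rightarrow> bool" where
  "mass M \<longleftrightarrow> finite_measure M \<and> sets M = sets borel \<and> absolutely_continuous lborel M"

(* The library's inner product on complex ^ 'd is the real one; this is the Hermitian one,
   conjugate-linear in the second argument. *)
definition cinner_vec :: "complex ^ 'd \<Rightarrow> complex ^ 'd \<Rightarrow> complex" where
  "cinner_vec u a = (\<Sum>i\<in>UNIV. u $ i * cnj (a $ i))"

(* vec.subspace and vec.dim refer to complex scalars, so vec.dim is the complex dimension. *)
definition complex_hyperplane :: "(complex ^ 'd) set \<Rightarrow> bool" where
  "complex_hyperplane H \<longleftrightarrow>
     (\<exists>p V. vec.subspace V \<and> vec.dim V + 1 = CARD('d) \<and> H = (\<lambda>v. p + v) ` V)"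

definition unit_equation :: "complex ^ 'd \<Rightarrow> complex \<Rightarrow> (complex ^ 'd) set \<Rightarrow> bool" where
  "unit_equation a b H \<longleftrightarrow>
     a \<noteq> 0 \<and> (norm a)\<^sup>2 + (cmod b)\<^sup>2 = 1 \<and> H = {u. cinner_vec u a + cnj b = 0}"

definition regular_sector ::
    "nat \<Rightarrow> complex ^ 'd \<Rightarrow> complex \<Rightarrow> complex \<Rightarrow> (complex ^ 'd) set" where
  "regular_sector q a b l =
     {u. \<exists>v. cinner_vec u a + cnj b = l * v \<and> (v = 0 \<or> \<bar>Arg v\<bar> \<le> pi / real q)}"

(* The rotation-invariant probability measure on the unit circle: the image of the uniform
   distribution of the angle. *)
definition circle_measure :: "complex measure" where
  "circle_measure =
     distr (uniform_measure lborel {0..2 * pi}) (restrict_space borel (sphere 0 1)) cis"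

definition fourier_coeff :: "(complex \<Rightarrow> real) \<Rightarrow> int \<Rightarrow> complex" where
  "fourier_coeff f m = (\<integral>l. complex_of_real (f l) * l powi (- m) \<partial>circle_measure)"

end

theory Submission
  imports Defs
begin

text \<open>
  Write \<open>w(u) = \<langle>u, a\<rangle> + cnj b\<close> for a unit vector \<open>x = (a, b)\<close> of \<open>\<complex>\<^sup>d \<times> \<complex>\<close>.  Whether a point \<open>u\<close>
  lies in the sector of direction \<open>\<lambda>\<close> depends only on the direction of \<open>w(u)\<close> relative to \<open>\<lambda>\<close>, so
  exchanging the two integrations factorises the Fourier coefficient as \<open>c\<^sub>m(x) = \<kappa> f\<^sub>m(x)\<close>.  Here
  \<open>\<kappa>\<close> depends on \<open>q\<close> and \<open>m\<close> only and \<open>f\<^sub>m(x) = \<integral> cnj (sgn (w u)) ^ m d\<mu>(u)\<close>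
  (\<open>fourier_coeff_regular_sector\<close>).  The function \<open>f\<^sub>m\<close> is continuous on the unit sphere, because a
  mass does not charge the hyperplane \<open>w = 0\<close>, and \<open>f\<^sub>m(\<lambda>x) = \<lambda>\<^sup>m f\<^sub>m(x)\<close>.  A common zero of the \<open>d\<close>
  functions belonging to the \<open>d\<close> masses is therefore provided by the Borsuk-Ulam theorem for circle
  actions (\<open>circle_Borsuk_Ulam\<close>).  Such a zero has \<open>a \<noteq> 0\<close> as soon as one pair \<open>(\<mu>\<^sub>j, m\<^sub>j)\<close>
  has \<open>\<kappa> \<noteq> 0\<close> and \<open>\<mu>\<^sub>j \<noteq> 0\<close>, since at \<open>a = 0\<close> the integrand is a nonzero constant;
  the other pairs have vanishing coefficients for every hyperplane.

  The Borsuk-Ulam theorem is proved as follows.  Powers of the given functions all have one common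
  weight \<open>M\<close>, and a smooth approximation of that weight is obtained from the Weierstrass theorem by
  averaging over roots of unity.  So suppose that \<open>F\<close>, from \<open>\<complex>\<^sup>d \<times> \<complex>\<close> to \<open>\<complex>\<^sup>d\<close>, is
  smooth of weight \<open>M\<close> and has no zero on the sphere.  On the subsphere \<open>b = 0\<close>, a generic small
  perturbation of \<open>F\<close> can be joined to the power map \<open>(z\<^sub>i)\<^sub>i \<mapsto> (z\<^sub>i\<^sup>M)\<^sub>i\<close> by a straight-line
  homotopy without zeros: modulo the circle, the pairs of a point and a homotopy parameter have real
  dimension \<open>2d - 1\<close>, and a zero imposes \<open>2d\<close> real conditions (\<open>generic_perturbation\<close>).
  On the other hand \<open>F\<close> extends over the ball that the hemisphere \<open>b \<ge> 0\<close> forms, so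
  the power map on a sphere extends to the ball without zeros.

  That this is impossible is a degree argument (\<open>power_map_zero_if_eq_on_sphere\<close>).  The integral of
  the Jacobian determinant of a smooth map over a ball depends only on the boundary values
  (\<open>integral_det_eq_if_eq_on_sphere\<close>): after adding \<open>c\<cdot>id\<close> with large \<open>c\<close> both maps are injective with
  the same image, so the integrals are equal volumes; both are polynomials in \<open>c\<close>, hence agree for
  \<open>c = 0\<close>.  Composing with a map that is constant in each coordinate away from \<open>0\<close> makes the
  determinant of the zero-free extension vanish identically, while that of the power map is
  nonnegative and positive somewhere.
\<close>

section \<open>Continuously differentiable maps\<close>

text \<open>
  The derivative is the two-sided one even at boundary points of \<open>S\<close>.  In finite dimension,
  continuity of \<open>x \<mapsto> f' x h\<close> for each \<open>h\<close> is the same as continuity in operator norm and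
  is easier to check for concrete formulas.
\<close>

definition c1_on :: "'a::euclidean_space set \<Rightarrow> ('a \<Rightarrow> 'b::euclidean_space) \<Rightarrow> bool" where
  "c1_on S f \<longleftrightarrow> (\<exists>f'. (\<forall>x\<in>S. (f has_derivative f' x) (at x)) \<and> (\<forall>h. continuous_on S (\<lambda>x. f' x h)))"

lemma c1_onI:
  assumes "\<And>x. x \<in> S \<Longrightarrow> (f has_derivative f' x) (at x)" "\<And>h. continuous_on S (\<lambda>x. f' x h)"
  shows "c1_on S f"
  using assms unfolding c1_on_def by blast

lemma c1_onE:
  assumes "c1_on S f"
  obtains f' where "\<And>x. x \<in> S \<Longrightarrow> (f has_derivative f' x) (at x)" "\<And>h. continuous_on S (\<lambda>x. f' x h)"
  using assms unfolding c1_on_def by blast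

lemma c1_on_subset: "c1_on S f \<Longrightarrow> T \<subseteq> S \<Longrightarrow> c1_on T f"
  unfolding c1_on_def by (meson continuous_on_subset subsetD)

lemma c1_on_imp_continuous_on: "c1_on S f \<Longrightarrow> continuous_on S f"
  by (meson c1_onE continuous_at_imp_continuous_on has_derivative_continuous)

lemma c1_on_imp_differentiable_on: "c1_on S f \<Longrightarrow> f differentiable_on S"
  by (meson c1_onE differentiableI differentiable_at_imp_differentiable_on)

lemma c1_on_linear: "bounded_linear f \<Longrightarrow> c1_on S f"
  by (rule c1_onI[where f'="\<lambda>_. f"]) (auto intro: bounded_linear_imp_has_derivative)

lemma c1_on_const: "c1_on S (\<lambda>x. c)"
  by (rule c1_onI[where f'="\<lambda>_ _. 0"]) auto

lemma c1_on_ident: "c1_on S (\<lambda>x. x)"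
  by (rule c1_on_linear) (rule bounded_linear_ident)

lemma c1_on_add:
  assumes "c1_on S f" "c1_on S g" shows "c1_on S (\<lambda>x. f x + g x)"
proof -
  obtain f' where f: "\<And>x. x \<in> S \<Longrightarrow> (f has_derivative f' x) (at x)" "\<And>h. continuous_on S (\<lambda>x. f' x h)"
    using assms(1) by (rule c1_onE) blast
  obtain g' where g: "\<And>x. x \<in> S \<Longrightarrow> (g has_derivative g' x) (at x)" "\<And>h. continuous_on S (\<lambda>x. g' x h)"
    using assms(2) by (rule c1_onE) blast
  show ?thesis
    by (rule c1_onI[where f'="\<lambda>x h. f' x h + g' x h"]) (intro has_derivative_add continuous_intros f g | assumption)+
qed

lemma c1_on_sum:
  assumes "finite I" "\<And>i. i \<in> I \<Longrightarrow> c1_on S (f i)" shows "c1_on S (\<lambda>x. \<Sum>i\<in>I. f i x)"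
  using assms by (induction I rule: finite_induct) (auto intro: c1_on_const c1_on_add)

lemma c1_on_bilinear:
  fixes pr :: "'b::euclidean_space \<Rightarrow> 'c::euclidean_space \<Rightarrow> 'd::euclidean_space"
  assumes pr: "bounded_bilinear pr" and "c1_on S f" "c1_on S g"
  shows "c1_on S (\<lambda>x. pr (f x) (g x))"
proof -
  obtain f' where f: "\<And>x. x \<in> S \<Longrightarrow> (f has_derivative f' x) (at x)" "\<And>h. continuous_on S (\<lambda>x. f' x h)"
    using assms(2) by (rule c1_onE) blast
  obtain g' where g: "\<And>x. x \<in> S \<Longrightarrow> (g has_derivative g' x) (at x)" "\<And>h. continuous_on S (\<lambda>x. g' x h)"
    using assms(3) by (rule c1_onE) blast
  show ?thesis
    by (rule c1_onI[where f'="\<lambda>x h. pr (f x) (g' x h) + pr (f' x h) (g x)"])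
       (intro bounded_bilinear.FDERIV[OF pr] continuous_on_add bounded_bilinear.continuous_on[OF pr]
          f g c1_on_imp_continuous_on[OF assms(2)] c1_on_imp_continuous_on[OF assms(3)] | assumption)+
qed

lemmas c1_on_mult = c1_on_bilinear[OF bounded_bilinear_mult]
lemmas c1_on_scaleR = c1_on_bilinear[OF bounded_bilinear_scaleR]
lemmas c1_on_inner = c1_on_bilinear[OF bounded_bilinear_inner]

lemma c1_on_power:
  fixes f :: "'a::euclidean_space \<Rightarrow> 'b::{euclidean_space, real_normed_algebra_1}"
  shows "c1_on S f \<Longrightarrow> c1_on S (\<lambda>x. f x ^ n)"
  by (induction n) (auto intro: c1_on_const c1_on_mult)

lemma c1_on_compose:
  assumes g: "c1_on T g" and f: "c1_on S f" and "f ` S \<subseteq> T"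
  shows "c1_on S (\<lambda>x. g (f x))"
proof -
  obtain f' where f': "\<And>x. x \<in> S \<Longrightarrow> (f has_derivative f' x) (at x)" "\<And>h. continuous_on S (\<lambda>x. f' x h)"
    using f by (rule c1_onE) blast
  obtain g' where g': "\<And>x. x \<in> T \<Longrightarrow> (g has_derivative g' x) (at x)" "\<And>h. continuous_on T (\<lambda>x. g' x h)"
    using g by (rule c1_onE) blast
  have eq: "g' (f x) (f' x h) = (\<Sum>b\<in>Basis. (f' x h \<bullet> b) *\<^sub>R g' (f x) b)" if "x \<in> S" for x h
  proof -
    have "linear (g' (f x))"
      using g'(1)[of "f x"] that assms(3) has_derivative_linear by blast
    then show ?thesis
      by (subst euclidean_representation[of "f' x h", symmetric])
         (simp add: linear_sum linear_cmul)
  qed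
  show ?thesis
  proof (rule c1_onI)
    show "((\<lambda>x. g (f x)) has_derivative (\<lambda>h. g' (f x) (f' x h))) (at x)" if "x \<in> S" for x
      using diff_chain_at[OF f'(1)[OF that] g'(1)[of "f x"]] that assms(3) by (auto simp: o_def)
    have "continuous_on S (\<lambda>x. g' (f x) b)" for b
      by (rule continuous_on_compose2[OF g'(2) c1_on_imp_continuous_on[OF f] assms(3)])
    then have "continuous_on S (\<lambda>x. \<Sum>b\<in>Basis. (f' x h \<bullet> b) *\<^sub>R g' (f x) b)" for h
      by (intro continuous_intros f')
    then show "continuous_on S (\<lambda>x. g' (f x) (f' x h))" for h
      using eq by (simp cong: continuous_on_cong_simp)
  qed
qed

lemma c1_on_bounded_linear:
  "bounded_linear g \<Longrightarrow> c1_on S f \<Longrightarrow> c1_on S (\<lambda>x. g (f x))"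
  using c1_on_compose[OF c1_on_linear, of g S f UNIV] by auto

lemma c1_on_real:
  assumes "\<And>x. x \<in> S \<Longrightarrow> (f has_real_derivative f' x) (at x)" "continuous_on S f'"
  shows "c1_on S f"
  using assms by (intro c1_onI[where f'="\<lambda>x h. f' x * h"])
    (auto simp: has_field_derivative_def intro!: continuous_intros)

lemma c1_on_Pair:
  assumes "c1_on S f" "c1_on S g" shows "c1_on S (\<lambda>x. (f x, g x))"
proof -
  have "c1_on S (\<lambda>x. (f x, 0) + (0, g x))"
    using assms by (intro c1_on_add c1_on_bounded_linear[of "\<lambda>z. (z, 0)"] c1_on_bounded_linear[of "\<lambda>z. (0, z)"])
      (auto intro!: bounded_linear_intros)
  then show ?thesis by simp
qed

lemma bounded_linear_axis: "bounded_linear (axis i :: 'a::euclidean_space \<Rightarrow> 'a ^ 'n)"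
  by (auto intro!: linearI simp: linear_conv_bounded_linear[symmetric] axis_def vec_eq_iff)

lemma vec_lambda_eq_sum_axis: "(\<chi> i. f i) = (\<Sum>i\<in>UNIV. axis i (f i :: 'a::real_normed_vector))"
  by (simp add: vec_eq_iff sum_component axis_def)

lemma has_derivative_vec_lambda:
  fixes f :: "'n::finite \<Rightarrow> 'a::real_normed_vector \<Rightarrow> 'b::euclidean_space"
  assumes "\<And>i. (f i has_derivative f' i) F"
  shows "((\<lambda>x. \<chi> i. f i x) has_derivative (\<lambda>h. \<chi> i. f' i h)) F"
  unfolding vec_lambda_eq_sum_axis
  by (intro has_derivative_sum bounded_linear.has_derivative[OF bounded_linear_axis] assms)

lemma c1_on_vec_lambda:
  fixes f :: "'n::finite \<Rightarrow> 'a::euclidean_space \<Rightarrow> 'b::euclidean_space"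
  assumes "\<And>i. c1_on S (f i)" shows "c1_on S (\<lambda>x. \<chi> i. f i x)"
  unfolding vec_lambda_eq_sum_axis
  by (intro c1_on_sum c1_on_bounded_linear[OF bounded_linear_axis] assms) auto

lemma c1_on_vec_nth:
  "c1_on S f \<Longrightarrow> c1_on S (\<lambda>x. f x $ i)"
  by (rule c1_on_bounded_linear[OF bounded_linear_vec_nth])

text \<open>
  Squares of positive parts serve below as building blocks of all cut-off functions.
\<close>

lemma has_real_derivative_max_square:
  "((\<lambda>x::real. (max 0 x)\<^sup>2) has_real_derivative 2 * max 0 x) (at x)"
proof (cases "x = 0")
  case True
  have "((\<lambda>y. (max 0 y)\<^sup>2 / y) \<longlongrightarrow> 0) (at (0::real))"
  proof (rule Lim_null_comparison)
    show "\<forall>\<^sub>F y in at 0. norm ((max 0 y)\<^sup>2 / y) \<le> \<bar>y::real\<bar>"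
      by (rule always_eventually) (auto simp: max_def power2_eq_square)
    show "((\<lambda>y::real. \<bar>y\<bar>) \<longlongrightarrow> 0) (at 0)"
      by (intro tendsto_eq_intros) auto
  qed
  then show ?thesis using True by (simp add: has_field_derivative_iff)
next
  case False
  then consider "x > 0" | "x < 0" by linarith
  then show ?thesis
  proof cases
    case 1
    have "((\<lambda>x. x\<^sup>2) has_real_derivative 2 * max 0 x) (at x)"
      using 1 by (auto intro!: derivative_eq_intros)
    then show ?thesis
      by (rule has_field_derivative_transform_within_open[where S="{0<..}"]) (use 1 in auto)
  next
    case 2
    have "((\<lambda>x. 0) has_real_derivative 2 * max 0 x) (at x)"
      using 2 by (auto intro!: derivative_eq_intros)
    then show ?thesis
      by (rule has_field_derivative_transform_within_open[where S="{..<0}"]) (use 2 in auto)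
  qed
qed

lemma c1_on_max_square: "c1_on UNIV (\<lambda>x::real. (max 0 x)\<^sup>2)"
  by (rule c1_on_real[OF has_real_derivative_max_square]) (intro continuous_intros)

lemma c1_on_derivative_bounded:
  fixes f' :: "'a::euclidean_space \<Rightarrow> 'c::euclidean_space \<Rightarrow> 'b::euclidean_space"
  assumes "\<And>x. x \<in> K \<Longrightarrow> linear (f' x)" "\<And>h. continuous_on K (\<lambda>x. f' x h)" "compact K"
  obtains L where "L > 0" "\<And>x. x \<in> K \<Longrightarrow> onorm (f' x) \<le> L"
proof -
  have "continuous_on K (\<lambda>x. \<Sum>b\<in>Basis. norm (f' x b))"
    by (intro continuous_intros assms)
  then have "bounded ((\<lambda>x. \<Sum>b\<in>Basis. norm (f' x b)) ` K)"
    using assms(3) compact_continuous_image compact_imp_bounded by blast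
  then obtain L where L: "L > 0" "\<And>x. x \<in> K \<Longrightarrow> norm (\<Sum>b\<in>Basis. norm (f' x b)) \<le> L"
    unfolding bounded_pos by auto
  have "onorm (f' x) \<le> L" if "x \<in> K" for x
  proof (rule onorm_le)
    fix h
    have "f' x h = (\<Sum>b\<in>Basis. (h \<bullet> b) *\<^sub>R f' x b)"
      by (subst euclidean_representation[of h, symmetric])
         (simp add: linear_sum linear_cmul assms(1)[OF that])
    also have "norm \<dots> \<le> (\<Sum>b\<in>Basis. norm h * norm (f' x b))"
      by (rule sum_norm_le) (simp add: mult_right_mono Basis_le_norm)
    also have "\<dots> = (\<Sum>b\<in>Basis. norm (f' x b)) * norm h"
      by (simp add: sum_distrib_left mult.commute)
    also have "\<dots> \<le> L * norm h"
      using L(2)[OF that] by (intro mult_right_mono) auto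
    finally show "norm (f' x h) \<le> L * norm h" .
  qed
  with L(1) that show thesis by blast
qed

section \<open>The integral of the Jacobian determinant over a ball\<close>

text \<open>
  The leading terms of a polynomial and of its translate cancel.
\<close>

lemma degree_diff_shift_less:
  fixes p :: "real poly"
  assumes "degree p \<le> Suc n"
  shows "degree (p - pcompose p [:c, 1:]) \<le> n"
proof (cases "degree p = 0")
  case True
  then obtain a where "p = [:a:]" by (rule degree_eq_zeroE)
  then show ?thesis by simp
next
  case False
  let ?r = "p - pcompose p [:c, 1:]"
  have deg: "degree (pcompose p [:c, 1:]) = degree p"
    by (simp add: degree_pcompose)
  have "lead_coeff (pcompose p [:c, 1:]) = lead_coeff p"
    by (subst lead_coeff_comp) auto
  then have lc: "coeff ?r (degree p) = 0"
    using deg by simp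
  have "degree ?r \<le> degree p"
    by (rule degree_diff_le) (simp_all add: deg)
  moreover have "degree ?r \<noteq> degree p"
    using lc False by (metis degree_0 leading_coeff_0_iff)
  ultimately show ?thesis using assms by linarith
qed

lemma alternating_sum_choose_Suc:
  fixes f :: "nat \<Rightarrow> real"
  shows "(\<Sum>k\<le>Suc n. (-1) ^ k * of_nat (Suc n choose k) * f k) =
         (\<Sum>k\<le>n. (-1) ^ k * of_nat (n choose k) * (f k - f (Suc k)))"
proof -
  have "(\<Sum>k\<le>Suc n. (-1) ^ k * of_nat (Suc n choose k) * f k) =
        f 0 + (\<Sum>k\<le>n. (-1) ^ Suc k * of_nat (Suc n choose Suc k) * f (Suc k))"
    by (subst sum.atMost_Suc_shift) simp
  also have "\<dots> = (f 0 + (\<Sum>k\<le>n. (-1) ^ Suc k * of_nat (n choose Suc k) * f (Suc k)))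
                   - (\<Sum>k\<le>n. (-1) ^ k * of_nat (n choose k) * f (Suc k))"
    unfolding add_diff_eq[symmetric] sum_subtractf[symmetric]
    by (intro arg_cong2[where f="(+)"] sum.cong refl) (simp add: algebra_simps)
  also have "f 0 + (\<Sum>k\<le>n. (-1) ^ Suc k * of_nat (n choose Suc k) * f (Suc k)) =
             (\<Sum>k\<le>Suc n. (-1) ^ k * of_nat (n choose k) * f k)"
    by (subst sum.atMost_Suc_shift) simp
  also have "\<dots> = (\<Sum>k\<le>n. (-1) ^ k * of_nat (n choose k) * f k)"
    by simp
  finally show ?thesis
    by (simp add: right_diff_distrib sum_subtractf)
qed

text \<open>
  Finite differences of order \<open>Suc n\<close> annihilate polynomials of degree at most \<open>n\<close>.  Solved for the
  term \<open>k = 0\<close>, this extrapolates the value at \<open>0\<close> from the values at the points \<open>k * c\<close>,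
  \<open>k \<ge> 1\<close>, all of which are large if \<open>c\<close> is.
\<close>

lemma alternating_sum_poly_eq_0:
  fixes p :: "real poly"
  assumes "degree p \<le> n"
  shows "(\<Sum>k\<le>Suc n. (-1) ^ k * of_nat (Suc n choose k) * poly p (of_nat k * c)) = 0"
  using assms
proof (induction n arbitrary: p)
  case 0
  then obtain a where "p = [:a:]" by (auto elim: degree_eq_zeroE)
  then show ?case by simp
next
  case (Suc n)
  let ?q = "p - pcompose p [:c, 1:]"
  have "poly p (of_nat k * c) - poly p (of_nat (Suc k) * c) = poly ?q (of_nat k * c)" for k
    by (simp add: poly_pcompose algebra_simps)
  then show ?case
    by (subst alternating_sum_choose_Suc) (simp only: Suc.IH[OF degree_diff_shift_less[OF Suc.prems]])
qed

lemma det_shift_polynomial: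
  fixes f :: "real ^ 'n \<Rightarrow> real ^ 'n"
  obtains p where "degree p \<le> CARD('n)" "\<And>c. poly p c = det (matrix (\<lambda>v. c *\<^sub>R v + f v))"
proof
  let ?e = "\<lambda>i j. [:f (axis j 1) $ i, if i = j then 1 else 0:]"
  let ?p = "\<Sum>\<sigma> | \<sigma> permutes (UNIV::'n set). smult (of_int (sign \<sigma>)) (\<Prod>i\<in>UNIV. ?e i (\<sigma> i))"
  show "degree ?p \<le> CARD('n)"
  proof (rule degree_sum_le)
    fix \<sigma> :: "'n \<Rightarrow> 'n"
    have "degree (smult (of_int (sign \<sigma>) :: real) (\<Prod>i\<in>UNIV. ?e i (\<sigma> i))) \<le>
          degree (\<Prod>i\<in>UNIV. ?e i (\<sigma> i))"
      by (rule degree_smult_le)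
    also have "\<dots> \<le> sum (degree \<circ> (\<lambda>i. ?e i (\<sigma> i))) UNIV"
      by (rule degree_prod_sum_le) simp
    also have "\<dots> \<le> sum (\<lambda>_. 1) (UNIV :: 'n set)"
      by (rule sum_mono) auto
    finally show "degree (smult (of_int (sign \<sigma>) :: real) (\<Prod>i\<in>UNIV. ?e i (\<sigma> i))) \<le> CARD('n)"
      by simp
  qed simp
  show "poly ?p c = det (matrix (\<lambda>v. c *\<^sub>R v + f v))" for c
    unfolding det_def poly_sum poly_smult poly_prod
    by (intro sum.cong refl arg_cong2[where f="(*)"] prod.cong)
       (auto simp: matrix_def axis_def)
qed

text \<open>
  The determinant has no zero along the segment from \<open>c\<cdot>id\<close> to \<open>c\<cdot>id + A\<close>, so it keeps its sign.
\<close>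

lemma det_shift_pos:
  fixes A :: "real ^ 'n \<Rightarrow> real ^ 'n"
  assumes A: "linear A" and L: "onorm A \<le> L" and c: "L < c"
  shows "det (matrix (\<lambda>v. c *\<^sub>R v + A v)) > 0"
proof -
  have bl: "bounded_linear A" using A by (simp add: linear_conv_bounded_linear)
  have c0: "c > 0" using onorm_pos_le[OF bl] L c by linarith
  obtain p where p: "\<And>c. poly p c = det (matrix (\<lambda>v. c *\<^sub>R v + A v))"
    using det_shift_polynomial by blast
  let ?h = "\<lambda>t. det (matrix (\<lambda>v. c *\<^sub>R v + t *\<^sub>R A v))"
  have nz: "?h t \<noteq> 0" if t: "0 \<le> t" "t \<le> 1" for t
  proof
    assume 0: "?h t = 0"
    have lin: "linear (\<lambda>v. c *\<^sub>R v + t *\<^sub>R A v)"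
      using A by (intro linear_compose_add linear_compose_scale_right) (auto simp: linear_id[unfolded id_def])
    have "\<not> inj (\<lambda>v. c *\<^sub>R v + t *\<^sub>R A v)"
      using 0 lin det_nz_iff_inj by blast
    then obtain v where v: "v \<noteq> 0" "c *\<^sub>R v + t *\<^sub>R A v = 0"
      using lin linear_injective_0 by blast
    have "norm (c *\<^sub>R v) = norm (t *\<^sub>R A v)"
      using v(2) by (metis add_eq_0_iff norm_minus_cancel)
    also have "\<dots> \<le> 1 * norm (A v)"
      using t by (simp add: mult_left_le_one_le)
    also have "\<dots> \<le> L * norm v"
      using order.trans[OF onorm[OF bl] mult_right_mono[OF L norm_ge_zero]] by simp
    finally have "c * norm v \<le> L * norm v" using c0 by simp
    then show False using c v(1) by simp
  qed
  have cont: "continuous_on {0..1} ?h"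
    unfolding det_def matrix_def by (simp, intro continuous_intros)
  have "?h 0 > 0"
  proof -
    have "matrix (\<lambda>v. c *\<^sub>R v + 0 *\<^sub>R A v) = (\<chi> i j. if i = j then c else 0)"
      by (auto simp: matrix_def vec_eq_iff axis_def)
    then show ?thesis using c0 by (simp add: det_diagonal prod_pos)
  qed
  moreover have False if "?h 1 \<le> 0"
    using IVT2'[of ?h 1 0 0, OF that _ _ cont] \<open>?h 0 > 0\<close> nz by force
  ultimately show ?thesis by force
qed

text \<open>
  Solving \<open>c *\<^sub>R x + g x = y\<close> for \<open>x\<close> is a fixed point problem for a contraction.
\<close>

lemma bij_shift_Lipschitz:
  fixes g :: "'a::euclidean_space \<Rightarrow> 'a"
  assumes lip: "\<And>x y. dist (g x) (g y) \<le> L * dist x y" and L: "0 \<le> L" "L < c"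
  shows "bij (\<lambda>x. c *\<^sub>R x + g x)"
proof (rule bijI')
  have c: "c > 0" using L by linarith
  have ex1: "\<exists>!x. (y - g x) /\<^sub>R c = x" for y
  proof (rule banach_fix_type[of "L / c"])
    show "\<forall>x z. dist ((y - g x) /\<^sub>R c) ((y - g z) /\<^sub>R c) \<le> L / c * dist x z"
    proof (intro allI)
      fix x z
      have "dist ((y - g x) /\<^sub>R c) ((y - g z) /\<^sub>R c) = dist (g x) (g z) / c"
        using c by (simp add: dist_norm scaleR_diff_right[symmetric] norm_minus_commute divide_inverse)
      also have "\<dots> \<le> L * dist x z / c"
        using lip c by (intro divide_right_mono) auto
      finally show "dist ((y - g x) /\<^sub>R c) ((y - g z) /\<^sub>R c) \<le> L / c * dist x z" by simp
    qed
  qed (use L c in auto)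
  have eq: "(y - g x) /\<^sub>R c = x \<longleftrightarrow> c *\<^sub>R x + g x = y" for x y
  proof -
    have "(y - g x) /\<^sub>R c = x \<longleftrightarrow> c *\<^sub>R ((y - g x) /\<^sub>R c) = c *\<^sub>R x"
      using c by (subst scaleR_cancel_left) auto
    then show ?thesis using c by (auto simp: algebra_simps)
  qed
  show "c *\<^sub>R x + g x = c *\<^sub>R z + g z \<longleftrightarrow> x = z" for x z
    using ex1[of "c *\<^sub>R x + g x"] eq by metis
  show "\<exists>x. y = c *\<^sub>R x + g x" for y
    using ex1[of y] eq by metis
qed

text \<open>
  For large \<open>c\<close> the determinants are Jacobians of injective maps, so their integrals are the volumes of
  the images of the ball.  To see that the images coincide, both maps are extended to bijections
  of the whole space by means of the nearest-point projection onto the ball; the extensions agree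
  outside the open ball, hence have the same image of the complement, hence of the ball.
\<close>

lemma integral_det_shift_eq:
  fixes F G :: "real ^ 'n::{finite,wellorder} \<Rightarrow> real ^ 'n::_"
  assumes F: "\<And>x. x \<in> cball 0 R \<Longrightarrow> (F has_derivative F' x) (at x)"
    and G: "\<And>x. x \<in> cball 0 R \<Longrightarrow> (G has_derivative G' x) (at x)"
    and LF: "\<And>x. x \<in> cball 0 R \<Longrightarrow> onorm (F' x) \<le> L"
    and LG: "\<And>x. x \<in> cball 0 R \<Longrightarrow> onorm (G' x) \<le> L"
    and eq: "\<And>x. x \<in> sphere 0 R \<Longrightarrow> F x = G x"
    and c: "L < c" and R: "R > 0"
  shows "\<exists>m. ((\<lambda>x. det (matrix (\<lambda>v. c *\<^sub>R v + F' x v))) has_integral m) (ball 0 R) \<and>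
             ((\<lambda>x. det (matrix (\<lambda>v. c *\<^sub>R v + G' x v))) has_integral m) (ball 0 R)"
proof -
  let ?B = "cball (0::real^'n::_) R" and ?U = "ball (0::real^'n::_) R"
  define cp where "cp = closest_point ?B"
  have cp_mem: "cp x \<in> ?B" for x
    unfolding cp_def using R by (intro closest_point_in_set) auto
  have cp_id: "cp x = x" if "x \<in> ?B" for x
    unfolding cp_def using that by (rule closest_point_self)
  have cp_sphere: "cp x \<in> sphere 0 R" if "x \<notin> ?U" for x
  proof (cases "x \<in> ?B")
    case True then show ?thesis using that cp_id by auto
  next
    case False
    have "cp x \<in> frontier ?B"
      using closest_point_in_rel_frontier[of ?B x] False R
      by (simp add: cp_def rel_frontier_nonempty_interior rel_interior_nonempty_interior affine_hull_nonempty_interior)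
    then show ?thesis by simp
  qed
  have L: "0 \<le> L"
    using LF[of 0] onorm_pos_le[of "F' 0"] F[of 0] R has_derivative_bounded_linear by force
  have shift: "inj (\<lambda>x. c *\<^sub>R x + H (cp x))" "surj (\<lambda>x. c *\<^sub>R x + H (cp x))"
    if H: "\<And>x. x \<in> ?B \<Longrightarrow> (H has_derivative H' x) (at x)" "\<And>x. x \<in> ?B \<Longrightarrow> onorm (H' x) \<le> L" for H H'
  proof -
    have "dist (H (cp x)) (H (cp y)) \<le> L * dist x y" for x y
    proof -
      have "dist (H (cp x)) (H (cp y)) \<le> L * dist (cp x) (cp y)"
        unfolding dist_norm
        by (rule differentiable_bound[of ?B _ H']) (use H cp_mem in \<open>auto intro: has_derivative_at_withinI\<close>)
      also have "\<dots> \<le> L * dist x y"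
        unfolding cp_def using R L
        by (intro mult_left_mono closest_point_lipschitz) auto
      finally show ?thesis .
    qed
    from bij_shift_Lipschitz[OF this L c]
    show "inj (\<lambda>x. c *\<^sub>R x + H (cp x))" "surj (\<lambda>x. c *\<^sub>R x + H (cp x))"
      by (auto simp: bij_def)
  qed
  have img: "((\<lambda>x. det (matrix (\<lambda>v. c *\<^sub>R v + H' x v))) has_integral
               measure lebesgue ((\<lambda>x. c *\<^sub>R x + H (cp x)) ` ?U)) ?U"
    if H: "\<And>x. x \<in> ?B \<Longrightarrow> (H has_derivative H' x) (at x)" "\<And>x. x \<in> ?B \<Longrightarrow> onorm (H' x) \<le> L" for H H'
  proof -
    let ?\<phi> = "\<lambda>x. c *\<^sub>R x + H (cp x)" and ?\<psi> = "\<lambda>x. c *\<^sub>R x + H x"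
    have im: "?\<phi> ` ?U = ?\<psi> ` ?U" by (rule image_cong) (auto simp: cp_id)
    have der: "(?\<psi> has_derivative (\<lambda>v. c *\<^sub>R v + H' x v)) (at x)" if "x \<in> ?B" for x
      by (auto intro!: derivative_eq_intros H that)
    have injU: "inj_on ?\<psi> ?U"
    proof (rule inj_onI)
      fix x y assume "x \<in> ?U" "y \<in> ?U" "?\<psi> x = ?\<psi> y"
      then have "?\<phi> x = ?\<phi> y" by (simp add: cp_id)
      then show "x = y" using shift(1)[OF H] by (auto dest: injD)
    qed
    have "continuous_on ?B ?\<psi>"
      using has_derivative_continuous[OF der] by (intro continuous_at_imp_continuous_on ballI)
    then have "bounded (?\<psi> ` ?B)"
      using compact_continuous_image compact_imp_bounded compact_cball by blast
    then have "bounded (?\<psi> ` ?U)" by (rule bounded_subset) auto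
    moreover have "?\<psi> ` ?U \<in> sets lebesgue"
    proof (rule differentiable_image_in_sets_lebesgue)
      show "?\<psi> differentiable_on ?U"
        by (intro differentiable_at_imp_differentiable_on ballI differentiableI[OF der]) auto
    qed auto
    ultimately have mble: "?\<psi> ` ?U \<in> lmeasurable"
      by (rule bounded_set_imp_lmeasurable)
    have derU: "(?\<psi> has_derivative (\<lambda>v. c *\<^sub>R v + H' x v)) (at x within ?U)" if "x \<in> ?U" for x
      by (rule has_derivative_at_withinI, rule der) (use that in auto)
    have Uleb: "?U \<in> sets lebesgue" by simp
    have "((\<lambda>x. \<bar>det (matrix (\<lambda>v. c *\<^sub>R v + H' x v))\<bar>) has_integral measure lebesgue (?\<psi> ` ?U)) ?U"
      by (rule iffD1[OF has_measure_differentiable_image[OF Uleb derU injU] conjI[OF mble refl]])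
    moreover have "\<bar>det (matrix (\<lambda>v. c *\<^sub>R v + H' x v))\<bar> = det (matrix (\<lambda>v. c *\<^sub>R v + H' x v))" if "x \<in> ?U" for x
      using det_shift_pos[OF has_derivative_linear[OF H(1)] H(2) c, of x] that by auto
    ultimately show ?thesis
      unfolding im by (subst has_integral_cong) auto
  qed
  have "(\<lambda>x. c *\<^sub>R x + F (cp x)) ` ?U = (\<lambda>x. c *\<^sub>R x + G (cp x)) ` ?U" (is "?f ` _ = ?g ` _")
  proof -
    have out: "?f ` (- ?U) = ?g ` (- ?U)"
      by (rule image_cong) (use cp_sphere eq in auto)
    have "?f ` ?U = - ?f ` (- ?U)"
      using bij_image_Compl_eq[of ?f "- ?U"] shift[OF F LF] by (simp add: bij_def)
    moreover have "?g ` ?U = - ?g ` (- ?U)"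
      using bij_image_Compl_eq[of ?g "- ?U"] shift[OF G LG] by (simp add: bij_def)
    ultimately show ?thesis using out by simp
  qed
  then show ?thesis using img[OF F LF] img[OF G LG]
    by (intro exI[of _ "measure lebesgue (?f ` ?U)"] conjI) simp_all
qed

text \<open>
  The determinant of \<open>c\<cdot>id + F' x\<close> is a polynomial in \<open>c\<close> of degree at most the dimension, and
  for large \<open>c\<close> the two integrals agree by the previous lemma.  Extrapolation to \<open>c = 0\<close> is a linear
  combination of finitely many of these integrals, with the same weights for \<open>F\<close> and \<open>G\<close>.
\<close>

theorem integral_det_eq_if_eq_on_sphere:
  fixes F G :: "real ^ 'n::{finite,wellorder} \<Rightarrow> real ^ 'n::_"
  assumes F: "\<And>x. x \<in> cball 0 R \<Longrightarrow> (F has_derivative F' x) (at x)"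
    and G: "\<And>x. x \<in> cball 0 R \<Longrightarrow> (G has_derivative G' x) (at x)"
    and F': "\<And>h. continuous_on (cball 0 R) (\<lambda>x. F' x h)"
    and G': "\<And>h. continuous_on (cball 0 R) (\<lambda>x. G' x h)"
    and eq: "\<And>x. x \<in> sphere 0 R \<Longrightarrow> F x = G x"
    and R: "R > 0"
  shows "\<exists>m. ((\<lambda>x. det (matrix (F' x))) has_integral m) (ball 0 R) \<and>
             ((\<lambda>x. det (matrix (G' x))) has_integral m) (ball 0 R)"
proof -
  obtain L1 where L1: "L1 > 0" "\<And>x. x \<in> cball 0 R \<Longrightarrow> onorm (F' x) \<le> L1"
    using c1_on_derivative_bounded[of "cball 0 R" F'] F F' has_derivative_linear compact_cball by metis
  obtain L2 where L2: "L2 > 0" "\<And>x. x \<in> cball 0 R \<Longrightarrow> onorm (G' x) \<le> L2"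
    using c1_on_derivative_bounded[of "cball 0 R" G'] G G' has_derivative_linear compact_cball by metis
  define L where "L = max L1 L2"
  have L: "L > 0" "\<And>x. x \<in> cball 0 R \<Longrightarrow> onorm (F' x) \<le> L" "\<And>x. x \<in> cball 0 R \<Longrightarrow> onorm (G' x) \<le> L"
    using L1 L2 by (force simp: L_def)+
  define c where "c = L + 1"
  define Q where "Q k m \<longleftrightarrow>
      ((\<lambda>x. det (matrix (\<lambda>v. (real k * c) *\<^sub>R v + F' x v))) has_integral m) (ball 0 R) \<and>
      ((\<lambda>x. det (matrix (\<lambda>v. (real k * c) *\<^sub>R v + G' x v))) has_integral m) (ball 0 R)" for k m
  have "\<exists>m. Q k m" if "k \<ge> 1" for k
    unfolding Q_def
  proof (rule integral_det_shift_eq[OF F G L(2) L(3) eq _ R])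
    have "1 * c \<le> real k * c" using that L(1) by (intro mult_right_mono) (auto simp: c_def)
    then show "L < real k * c" by (simp add: c_def)
  qed
  then obtain m where m: "\<And>k. k \<ge> 1 \<Longrightarrow> Q k (m k)"
    by metis
  let ?n = "CARD('n)"
  let ?w = "\<lambda>k. (-1) ^ Suc k * real (Suc ?n choose Suc k)"
  \<comment> \<open>The alternating sum over \<open>k\<close> from \<open>0\<close> to \<open>n + 1\<close> with its term \<open>k = 0\<close> split off, hence the shift by \<open>Suc\<close>.\<close>
  have extrapolate: "det (matrix A) = - (\<Sum>k\<le>?n. ?w k * det (matrix (\<lambda>v. (real (Suc k) * c) *\<^sub>R v + A v)))"
    for A :: "real ^ 'n::_ \<Rightarrow> real ^ 'n::_"
  proof -
    obtain p where p: "degree p \<le> ?n" "\<And>c. poly p c = det (matrix (\<lambda>v. c *\<^sub>R v + A v))"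
      using det_shift_polynomial by blast
    have "0 = poly p 0 + (\<Sum>k\<le>?n. ?w k * poly p (real (Suc k) * c))"
      using alternating_sum_poly_eq_0[OF p(1), of c] by (subst (asm) sum.atMost_Suc_shift) simp
    then show ?thesis unfolding p(2) by simp
  qed
  have int: "((\<lambda>x. det (matrix (H' x))) has_integral - (\<Sum>k\<le>?n. ?w k * m (Suc k))) (ball 0 R)"
    if "\<And>k. k \<ge> 1 \<Longrightarrow> ((\<lambda>x. det (matrix (\<lambda>v. (real k * c) *\<^sub>R v + H' x v))) has_integral m k) (ball 0 R)"
    for H' :: "real ^ 'n::_ \<Rightarrow> real ^ 'n::_ \<Rightarrow> real ^ 'n::_"
    by (subst extrapolate) (intro has_integral_neg has_integral_sum has_integral_mult_right that, auto)
  show ?thesis using int[of F'] int[of G'] m unfolding Q_def by blast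
qed

section \<open>Zeros of maps with prescribed boundary values\<close>

lemma det_scale_rows:
  fixes A :: "real ^ 'n \<Rightarrow> real ^ 'n"
  shows "det (matrix (\<lambda>h. \<chi> i. c i * A h $ i)) = (\<Prod>i\<in>UNIV. c i) * det (matrix A)"
proof -
  have "matrix (\<lambda>h. \<chi> i. c i * A h $ i) = (\<chi> i. c i *s (matrix A $ i))"
    by (simp add: matrix_def vec_eq_iff vector_scalar_mult_def)
  also have "det \<dots> = (\<Prod>i\<in>UNIV. c i) * det (\<chi> i. matrix A $ i)"
    by (rule det_rows_mul)
  finally show ?thesis by (simp add: vec_nth_inverse)
qed

text \<open>
  If \<open>H\<close> had no zero, then at each point of the ball some coordinate of \<open>H\<close> would have modulus at
  least \<open>\<epsilon>\<close>.  Let \<open>\<Phi>\<close> apply to each coordinate a function \<open>\<phi>\<close> whose derivative is positive on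
  \<open>(-\<epsilon>, \<epsilon>)\<close> and zero elsewhere.  The Jacobian determinant of \<open>\<Phi> \<circ> H\<close> then vanishes identically,
  and that of \<open>\<Phi> \<circ> P\<close> is nonnegative with the same integral, so it vanishes as well; but it is
  positive at points near \<open>0\<close>.
\<close>

theorem zero_if_eq_on_sphere_positive:
  fixes P H :: "real ^ 'n::{finite,wellorder} \<Rightarrow> real ^ 'n::_"
  assumes P: "\<And>x. x \<in> cball 0 R \<Longrightarrow> (P has_derivative P' x) (at x)"
    and P': "\<And>h. continuous_on (cball 0 R) (\<lambda>x. P' x h)"
    and det_nonneg: "\<And>x. x \<in> cball 0 R \<Longrightarrow> det (matrix (P' x)) \<ge> 0"
    and det_pos: "\<And>e. e > 0 \<Longrightarrow> \<exists>x\<in>cball 0 R. norm x < e \<and> det (matrix (P' x)) > 0"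
    and P0: "P 0 = 0"
    and H: "c1_on (cball 0 R) H"
    and eq: "\<And>x. x \<in> sphere 0 R \<Longrightarrow> H x = P x"
    and R: "R > 0"
  shows "\<exists>x\<in>cball 0 R. H x = 0"
proof (rule ccontr)
  assume no: "\<not> ?thesis"
  obtain H' where H': "\<And>x. x \<in> cball 0 R \<Longrightarrow> (H has_derivative H' x) (at x)"
    "\<And>h. continuous_on (cball 0 R) (\<lambda>x. H' x h)"
    using H by (rule c1_onE) blast
  have contP: "continuous_on (cball 0 R) P"
    using has_derivative_continuous[OF P] by (intro continuous_at_imp_continuous_on ballI)
  have contH: "continuous_on (cball 0 R) H"
    by (rule c1_on_imp_continuous_on[OF H])
  obtain x0 where x0: "x0 \<in> cball 0 R" "\<And>x. x \<in> cball 0 R \<Longrightarrow> norm (H x0) \<le> norm (H x)"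
  proof -
    have "continuous_on (cball 0 R) (\<lambda>x. norm (H x))" by (intro continuous_intros contH)
    moreover have "cball (0::real^'n::_) R \<noteq> {}" using R by auto
    ultimately have "\<exists>x\<in>cball 0 R. \<forall>y\<in>cball 0 R. norm (H x) \<le> norm (H y)"
      by (intro continuous_attains_inf compact_cball)
    then show ?thesis by (auto intro: that)
  qed
  define \<epsilon> where "\<epsilon> = norm (H x0) / CARD('n)"
  have \<epsilon>: "\<epsilon> > 0" using no x0 by (auto simp: \<epsilon>_def)
  have big: "\<exists>i. \<bar>H x $ i\<bar> \<ge> \<epsilon>" if "x \<in> cball 0 R" for x
  proof (rule ccontr)
    assume "\<not> ?thesis"
    then have "(\<Sum>i\<in>UNIV. \<bar>H x $ i\<bar>) < (\<Sum>i\<in>(UNIV::'n set). \<epsilon>)"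
      by (intro sum_strict_mono) (auto simp: not_le)
    also have "\<dots> = norm (H x0)" by (simp add: \<epsilon>_def)
    also have "\<dots> \<le> norm (H x)" using x0 that by simp
    finally show False using norm_le_l1_cart[of "H x"] by simp
  qed
  \<comment> \<open>A quadratic spline; its derivative \<open>\<tau>\<close> is the tent function supported on \<open>[-\<epsilon>, \<epsilon>]\<close>.\<close>
  define \<phi> where "\<phi> s = (max 0 (s + \<epsilon>))\<^sup>2 - 2 * (max 0 s)\<^sup>2 + (max 0 (s - \<epsilon>))\<^sup>2" for s
  define \<tau> where "\<tau> s = 2 * max 0 (s + \<epsilon>) - 4 * max 0 s + 2 * max 0 (s - \<epsilon>)" for s
  have \<phi>_deriv: "(\<phi> has_real_derivative \<tau> s) (at s)" for s
  proof -
    have "((\<lambda>s. (max 0 (s + a))\<^sup>2) has_real_derivative 2 * max 0 (s + a)) (at s)" for a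
      using DERIV_shift[of "\<lambda>x. (max 0 x)\<^sup>2" "2 * max 0 (s + a)" s a] has_real_derivative_max_square by simp
    from DERIV_add[OF DERIV_diff[OF this[of \<epsilon>] DERIV_cmult[OF this[of 0], of 2]] this[of "- \<epsilon>"]]
    show ?thesis unfolding \<phi>_def \<tau>_def by simp
  qed
  have \<tau>_nonneg: "\<tau> s \<ge> 0" and \<tau>_0: "\<epsilon> \<le> \<bar>s\<bar> \<Longrightarrow> \<tau> s = 0" and \<tau>_pos: "\<bar>s\<bar> < \<epsilon> \<Longrightarrow> \<tau> s > 0" for s
    using \<epsilon> by (auto simp: \<tau>_def max_def abs_if split: if_splits)
  have \<tau>_cont: "continuous_on S (\<lambda>x. \<tau> (f x))" if "continuous_on S f" for S and f :: "real^'n::_ \<Rightarrow> real"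
    unfolding \<tau>_def by (intro continuous_intros that)
  define \<Phi> where "\<Phi> v = (\<chi> i. \<phi> (v $ i))" for v :: "real^'n::_"
  have \<Phi>_deriv: "((\<lambda>x. \<Phi> (F x)) has_derivative (\<lambda>h. \<chi> i. \<tau> (F x $ i) * F' h $ i)) (at x)"
    if "(F has_derivative F') (at x)" for F F' x
    unfolding \<Phi>_def
  proof (rule has_derivative_vec_lambda)
    fix i
    have "((\<lambda>x. F x $ i) has_derivative (\<lambda>h. F' h $ i)) (at x)"
      by (rule bounded_linear.has_derivative[OF bounded_linear_vec_nth that])
    then show "((\<lambda>x. \<phi> (F x $ i)) has_derivative (\<lambda>h. \<tau> (F x $ i) * F' h $ i)) (at x)"
      using has_derivative_compose[OF _ \<phi>_deriv[unfolded has_field_derivative_def]] by blast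
  qed
  define DP where "DP x h = (\<chi> i. \<tau> (P x $ i) * P' x h $ i)" for x h
  define DH where "DH x h = (\<chi> i. \<tau> (H x $ i) * H' x h $ i)" for x h
  have contDP: "continuous_on (cball 0 R) (\<lambda>x. DP x h)" for h
    unfolding DP_def by (intro continuous_intros \<tau>_cont contP P')
  have "\<exists>m. ((\<lambda>x. det (matrix (DP x))) has_integral m) (ball 0 R) \<and>
            ((\<lambda>x. det (matrix (DH x))) has_integral m) (ball 0 R)"
  proof (rule integral_det_eq_if_eq_on_sphere)
    show "((\<lambda>x. \<Phi> (P x)) has_derivative DP x) (at x)" if "x \<in> cball 0 R" for x
      unfolding DP_def by (rule \<Phi>_deriv[OF P[OF that]])
    show "((\<lambda>x. \<Phi> (H x)) has_derivative DH x) (at x)" if "x \<in> cball 0 R" for x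
      unfolding DH_def by (rule \<Phi>_deriv[OF H'(1)[OF that]])
    show "continuous_on (cball 0 R) (\<lambda>x. DH x h)" for h
      unfolding DH_def by (intro continuous_intros \<tau>_cont contH H')
  qed (use contDP eq R in auto)
  then obtain m where m: "((\<lambda>x. det (matrix (DP x))) has_integral m) (ball 0 R)"
    "((\<lambda>x. det (matrix (DH x))) has_integral m) (ball 0 R)" by blast
  have "det (matrix (DH x)) = 0" if x: "x \<in> ball 0 R" for x
  proof -
    obtain i where "\<epsilon> \<le> \<bar>H x $ i\<bar>" using big[of x] x by auto
    then have "(\<Prod>i\<in>UNIV. \<tau> (H x $ i)) = 0"
      by (intro prod_zero bexI[of _ i] \<tau>_0) auto
    then show ?thesis unfolding DH_def det_scale_rows by simp
  qed
  then have "((\<lambda>x. det (matrix (DH x))) has_integral 0) (ball 0 R)"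
    by (intro has_integral_is_0) auto
  with m have int0: "((\<lambda>x. det (matrix (DP x))) has_integral 0) (ball 0 R)"
    using has_integral_unique by blast
  have det_DP: "det (matrix (DP x)) = (\<Prod>i\<in>UNIV. \<tau> (P x $ i)) * det (matrix (P' x))" for x
    unfolding DP_def by (rule det_scale_rows)
  have "((\<lambda>x. det (matrix (DP x))) has_integral 0) (closure (ball 0 R))"
  proof (rule iffD1[OF has_integral_spike_set_eq int0])
    show "negligible {x \<in> ball 0 R - closure (ball 0 R). det (matrix (DP x)) \<noteq> 0}"
      by (rule negligible_subset[OF negligible_empty]) (use closure_subset in blast)
    show "negligible {x \<in> closure (ball 0 R) - ball 0 R. det (matrix (DP x)) \<noteq> 0}"
      by (rule negligible_subset[OF negligible_sphere[of 0 R]]) (use R in auto)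
  qed
  then have zero: "det (matrix (DP x)) = 0" if "x \<in> cball 0 R" for x
  proof (rule has_integral_0_closure_imp_0[rotated 6])
    show "continuous_on (closure (ball 0 R)) (\<lambda>x. det (matrix (DP x)))"
      unfolding closure_ball[OF R] det_def matrix_def using contDP
      by (simp, intro continuous_intros) auto
    show "0 \<le> det (matrix (DP x))" if "x \<in> ball 0 R" for x
      unfolding det_DP using that by (intro mult_nonneg_nonneg prod_nonneg \<tau>_nonneg det_nonneg) auto
  qed (use R that in \<open>auto simp: emeasure_ball emeasure_cball emeasure_lborel_ball_finite\<close>)
  have "0 \<in> cball 0 R" using R by simp
  then have "continuous (at 0) P" using has_derivative_continuous[OF P] by blast
  then obtain e where e: "e > 0" "\<And>x. norm x < e \<Longrightarrow> norm (P x) < \<epsilon>"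
    using \<epsilon> P0 unfolding continuous_at_eps_delta by (metis dist_0_norm dist_commute)
  obtain x where x: "x \<in> cball 0 R" "norm x < e" "det (matrix (P' x)) > 0"
    using det_pos[OF e(1)] by blast
  have "\<tau> (P x $ i) > 0" for i
    using e(2)[OF x(2)] component_le_norm_cart[of "P x" i] by (intro \<tau>_pos) linarith
  then have "det (matrix (DP x)) > 0"
    unfolding det_DP using x(3) by (simp add: prod_pos)
  with zero[OF x(1)] show False by simp
qed

section \<open>Extensions of the power map\<close>

definition power_map :: "nat \<Rightarrow> complex ^ 'd \<Rightarrow> complex ^ 'd" where
  "power_map M z = (\<chi> i. (z $ i) ^ M)"

lemma power_map_nth [simp]: "power_map M z $ i = (z $ i) ^ M"
  by (simp add: power_map_def)

lemma power_map_eq_0_iff: "M > 0 \<Longrightarrow> power_map M z = 0 \<longleftrightarrow> z = 0"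
  by (simp add: vec_eq_iff)

text \<open>
  The derivative of the power map is a diagonal complex linear map.  Diagonal maps have complex square
  roots, which are again diagonal, so their real determinants are squares and thus nonnegative.
  The index type \<open>'d bit0\<close> has twice as many elements as \<open>'d\<close> and carries the well-order that the change of
  variables formula asks for.
\<close>

lemma power_map_zero_if_eq_on_sphere:
  fixes H :: "complex ^ 'd \<Rightarrow> complex ^ 'd"
  assumes H: "c1_on (cball 0 R) H" and eq: "\<And>x. x \<in> sphere 0 R \<Longrightarrow> H x = power_map M x"
    and M: "M > 0" and R: "R > 0"
  shows "\<exists>x\<in>cball 0 R. H x = 0"
proof -
  have "DIM(real ^ 'd bit0) = DIM(complex ^ 'd)" by simp
  then obtain T :: "real ^ 'd bit0 \<Rightarrow> complex ^ 'd" and S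
    where T: "linear T" and S: "linear S" and nT: "\<And>x. norm (T x) = norm x" and nS: "\<And>y. norm (S y) = norm y"
      and ST: "\<And>x. S (T x) = x" and TS: "\<And>y. T (S y) = y"
    using isomorphisms_UNIV_UNIV by blast
  have bT: "bounded_linear T" and bS: "bounded_linear S" using T S by (simp_all add: linear_conv_bounded_linear)
  define P where "P x = S (power_map M (T x))" for x
  define K where "K c h = S (\<chi> i. c i * T h $ i)" for c :: "'d \<Rightarrow> complex" and h
  define P' where "P' x = K (\<lambda>i. of_nat M * (T x $ i) ^ (M - 1))" for x
  have linK: "linear (K c)" for c
  proof -
    have "linear (\<lambda>v :: complex ^ 'd. \<chi> i. c i * v $ i)"
      by (rule linearI) (simp_all add: vec_eq_iff algebra_simps)
    then have "linear (S \<circ> ((\<lambda>v. \<chi> i. c i * v $ i) \<circ> T))"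
      by (intro linear_compose S T)
    then show ?thesis by (simp add: K_def[abs_def] o_def)
  qed
  have KK: "K c (K c' h) = K (\<lambda>i. c i * c' i) h" for c c' h
    by (simp add: K_def TS mult.assoc)
  have detK: "det (matrix (K c)) = (det (matrix (K (\<lambda>i. csqrt (c i)))))\<^sup>2" for c
  proof -
    have "K c = K (\<lambda>i. csqrt (c i)) \<circ> K (\<lambda>i. csqrt (c i))"
      by (auto simp: KK fun_eq_iff power2_eq_square[symmetric])
    then show ?thesis
      using matrix_compose[OF linK linK, of "\<lambda>i. csqrt (c i)" "\<lambda>i. csqrt (c i)"]
      by (simp add: det_mul power2_eq_square)
  qed
  have detK_pos: "det (matrix (K c)) > 0" if "\<And>i. c i \<noteq> 0" for c
  proof -
    have "K (\<lambda>i. inverse (c i)) (K c h) = h" for h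
      using that by (simp add: KK) (simp add: K_def ST)
    then have "inj (K c)" by (rule inj_on_inverseI)
    then have "det (matrix (K c)) \<noteq> 0" using det_nz_iff_inj[OF linK] by blast
    then show ?thesis by (metis detK zero_eq_power2 zero_less_power2)
  qed
  have derP: "(P has_derivative P' x) (at x)" for x
    unfolding P_def P'_def K_def power_map_def
  proof (intro bounded_linear.has_derivative[OF bS] has_derivative_vec_lambda)
    fix i
    have "((\<lambda>x. T x $ i) has_derivative (\<lambda>h. T h $ i)) (at x)"
      by (intro bounded_linear.has_derivative[OF bounded_linear_vec_nth] bounded_linear_imp_has_derivative bT)
    from has_derivative_power[OF this, of M]
    show "((\<lambda>x. (T x $ i) ^ M) has_derivative (\<lambda>h. of_nat M * (T x $ i) ^ (M - 1) * T h $ i)) (at x)"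
      by (simp add: mult_ac)
  qed
  have "\<exists>x\<in>cball 0 R. S (H (T x)) = 0"
  proof (rule zero_if_eq_on_sphere_positive[OF derP])
    show "continuous_on (cball 0 R) (\<lambda>x. P' x h)" for h
      unfolding P'_def K_def
      by (intro bounded_linear.continuous_on[OF bS] continuous_intros bounded_linear.continuous_on[OF bT])
    show "0 \<le> det (matrix (P' x))" for x
      unfolding P'_def by (subst detK) simp
    show "\<exists>x\<in>cball 0 R. norm x < e \<and> 0 < det (matrix (P' x))" if "e > 0" for e
    proof
      define u :: "complex ^ 'd" where "u = (\<chi> i. 1)"
      have u: "norm u > 0" by (auto simp: u_def vec_eq_iff)
      define t where "t = min R e / (2 * norm u)"
      have t: "t > 0" "t * norm u = min R e / 2" using u that R by (auto simp: t_def)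
      let ?x = "S (t *\<^sub>R u)"
      have nx: "norm ?x = min R e / 2" using t by (simp add: nS)
      then show "?x \<in> cball 0 R" using that R by auto
      have "0 < det (matrix (P' ?x))"
        unfolding P'_def using t M by (intro detK_pos) (auto simp: TS u_def)
      then show "norm ?x < e \<and> 0 < det (matrix (P' ?x))" using nx that R by auto
    qed
    show "P 0 = 0"
      using M by (simp add: P_def linear_0[OF S] linear_0[OF T] power_map_eq_0_iff[THEN iffD2])
    show "c1_on (cball 0 R) (\<lambda>x. S (H (T x)))"
      by (intro c1_on_bounded_linear[OF bS] c1_on_compose[OF H] c1_on_linear bT) (auto simp: nT)
    show "S (H (T x)) = P x" if "x \<in> sphere 0 R" for x
      using that by (simp add: P_def eq nT)
  qed (rule R)
  then obtain x where x: "x \<in> cball 0 R" "S (H (T x)) = 0" by blast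
  have "norm (H (T x)) = 0" using x(2) nS[of "H (T x)"] by simp
  moreover have "T x \<in> cball 0 R" using x(1) nT[of x] by simp
  ultimately have "T x \<in> cball 0 R" "H (T x) = 0" by auto
  then show ?thesis by blast
qed

section \<open>Generic perturbations of homogeneous maps\<close>

lemma c1_on_normalize:
  fixes f :: "'a::euclidean_space \<Rightarrow> 'b::euclidean_space"
  assumes f: "c1_on S f" and nz: "\<And>x. x \<in> S \<Longrightarrow> f x \<noteq> 0"
  shows "c1_on S (\<lambda>x. norm (f x))" "c1_on S (\<lambda>x. f x /\<^sub>R norm (f x))"
proof -
  have ff: "c1_on S (\<lambda>x. f x \<bullet> f x)" by (intro c1_on_inner f)
  have "c1_on {0<..} sqrt"
    by (rule c1_on_real[of _ _ "\<lambda>x. inverse (sqrt x) / 2"])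
       (auto intro!: DERIV_real_sqrt continuous_intros)
  from c1_on_compose[OF this ff] have "c1_on S (\<lambda>x. sqrt (f x \<bullet> f x))"
    using nz by (simp add: image_subset_iff)
  then show nrm: "c1_on S (\<lambda>x. norm (f x))"
    by (simp add: norm_eq_sqrt_inner)
  have "c1_on {0<..} (inverse :: real \<Rightarrow> real)"
  proof (rule c1_on_real)
    show "(inverse has_real_derivative - (inverse x ^ Suc (Suc 0))) (at x)" if "x \<in> {0<..}" for x :: real
      using that by (intro DERIV_inverse) auto
  qed (auto intro!: continuous_intros)
  from c1_on_compose[OF this nrm] have "c1_on S (\<lambda>x. inverse (norm (f x)))"
    using nz by (simp add: image_subset_iff)
  then show "c1_on S (\<lambda>x. f x /\<^sub>R norm (f x))"
    by (intro c1_on_scaleR f)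
qed

lemma c1_on_vector_scalar_mult:
  fixes v :: "'a::euclidean_space \<Rightarrow> complex ^ 'd"
  shows "c1_on S c \<Longrightarrow> c1_on S v \<Longrightarrow> c1_on S (\<lambda>x. c x *s v x)"
  unfolding vector_scalar_mult_def by (intro c1_on_vec_lambda c1_on_mult c1_on_vec_nth)

lemma norm_vector_scalar_mult: "norm (c *s (v :: complex ^ 'd)) = cmod c * norm v"
proof -
  have "norm (c *s v) = L2_set (\<lambda>i. cmod c * cmod (v $ i)) UNIV"
    by (simp add: norm_vec_def norm_mult)
  also have "\<dots> = cmod c * norm v"
    by (simp add: norm_vec_def L2_set_right_distrib)
  finally show ?thesis .
qed

lemma scaleR_eq_vector_scalar_mult: "r *\<^sub>R (v :: complex ^ 'd) = of_real r *s v"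
  by (simp add: vec_eq_iff scaleR_conv_of_real[symmetric] flip: scaleR_conv_of_real)

lemma power_map_scale: "power_map M (c *s z) = c ^ M *s power_map M z"
  by (simp add: vec_eq_iff power_mult_distrib)

text \<open>
  By equivariance a zero can be rotated and rescaled so that its \<open>k\<close>-th coordinate is \<open>1\<close> for some
  \<open>k\<close>; the equation can then be solved for the vector \<open>A $ k\<close>.  Hence the bad matrices \<open>A\<close> are
  parametrised by their remaining rows, the other coordinates of the zero, and the real number \<open>s\<close>.
  These data are packed into a matrix \<open>B\<close> of the same type as \<open>A\<close>: its row \<open>k\<close> holds the zero,
  with \<open>s\<close> in the slot of the coordinate that is known to be \<open>1\<close>.  As \<open>s\<close> is real, such \<open>B\<close> lie in
  the hyperplane \<open>Im (B $ k $ k) = 0\<close>, so the bad matrices form a smooth image of a null set.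
\<close>

lemma generic_perturbation:
  fixes g :: "complex ^ 'd \<Rightarrow> complex ^ 'd"
  assumes g: "c1_on (- {0}) g"
    and equiv: "\<And>l x. cmod l = 1 \<Longrightarrow> x \<noteq> 0 \<Longrightarrow> g (l *s x) = l ^ M *s g x"
    and e: "e > 0"
  shows "\<exists>A :: (complex ^ 'd) ^ 'd. (\<forall>k. norm (A $ k) < e) \<and>
    (\<forall>a s. norm a = 1 \<longrightarrow> g a + (\<Sum>k\<in>UNIV. (a $ k) ^ M *s (A $ k)) + complex_of_real s *s power_map M a \<noteq> 0)"
proof -
  define y :: "'d \<Rightarrow> (complex ^ 'd) ^ 'd \<Rightarrow> complex ^ 'd"
    where "y k B = (\<chi> j. if j = k then 1 else B $ k $ j)" for k B
  define col where "col k B = - ((of_real (norm (y k B))) ^ M *s g (y k B /\<^sub>R norm (y k B))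
      + of_real (Re (B $ k $ k)) *s power_map M (y k B)
      + (\<Sum>i\<in>UNIV - {k}. (y k B $ i) ^ M *s (B $ i)))" for k B
  define \<Psi> where "\<Psi> k B = (\<chi> i. if i = k then col k B else B $ i)" for k and B :: "(complex ^ 'd) ^ 'd"
  define N where "N k = {B :: (complex ^ 'd) ^ 'd. Im (B $ k $ k) = 0}" for k
  have y_nz: "y k B \<noteq> 0" for k B
    by (auto simp: y_def vec_eq_iff intro!: exI[of _ k])
  have comp: "c1_on UNIV (\<lambda>B :: (complex ^ 'd) ^ 'd. B $ i)" for i
    by (intro c1_on_vec_nth c1_on_ident)
  have "c1_on UNIV (\<lambda>B :: (complex ^ 'd) ^ 'd. if j = k then 1 else B $ k $ j)" for j k
    by (cases "j = k") (auto intro: c1_on_const c1_on_vec_nth comp)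
  then have y_c1: "c1_on UNIV (y k)" for k
    unfolding y_def[abs_def] by (rule c1_on_vec_lambda)
  note y_norm = c1_on_normalize[OF y_c1 y_nz]
  have "c1_on UNIV (\<lambda>B. g (y k B /\<^sub>R norm (y k B)))" for k
    by (rule c1_on_compose[OF g y_norm(2)]) (use y_nz in auto)
  then have col_c1: "c1_on UNIV (col k)" for k
    unfolding col_def[abs_def] power_map_def
    by (intro c1_on_bounded_linear[OF bounded_linear_minus[OF bounded_linear_ident]]
        c1_on_add c1_on_sum c1_on_vector_scalar_mult c1_on_power c1_on_vec_lambda
        c1_on_bounded_linear[OF bounded_linear_of_real] c1_on_bounded_linear[OF bounded_linear_Re] y_norm y_c1 c1_on_vec_nth comp) auto
  have "c1_on UNIV (\<lambda>B. if i = k then col k B else B $ i)" for i k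
    by (cases "i = k") (auto intro: col_c1 comp)
  then have \<Psi>_c1: "c1_on UNIV (\<Psi> k)" for k
    unfolding \<Psi>_def[abs_def] by (rule c1_on_vec_lambda)
  have "negligible (N k)" for k
  proof -
    have "N k = {B. axis k (axis k \<i>) \<bullet> B = 0}"
      by (auto simp: N_def inner_axis' inner_complex_def)
    moreover have "axis k (axis k \<i>) \<noteq> (0 :: (complex ^ 'd) ^ 'd)"
      by (simp add: axis_eq_0_iff)
    ultimately show ?thesis by (simp add: negligible_hyperplane)
  qed
  then have "negligible (\<Psi> k ` N k)" for k
    by (intro negligible_differentiable_image_negligible
        c1_on_imp_differentiable_on[OF c1_on_subset[OF \<Psi>_c1]]) auto
  then have negl: "negligible (\<Union>k. \<Psi> k ` N k)"
    by (intro negligible_Union) auto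
  have bad: "A \<in> (\<Union>k. \<Psi> k ` N k)"
    if a: "norm a = 1" and zero: "g a + (\<Sum>k\<in>UNIV. (a $ k) ^ M *s (A $ k)) + complex_of_real s *s power_map M a = 0"
    for A a s
  proof -
    obtain k where k: "a $ k \<noteq> 0" using a by (metis norm_zero vec_eq_iff zero_index zero_neq_one)
    define z where "z = inverse (a $ k) *s a"
    \<comment> \<open>The parameter matrix of the bad matrix \<open>A\<close>.\<close>
    define B where "B = (\<chi> i. if i = k then (\<chi> j. if j = k then of_real s else z $ j) else A $ i)"
    have zk: "z $ k = 1" using k by (simp add: z_def)
    have az: "a = a $ k *s z" using k by (simp add: z_def vec_eq_iff)
    have yB: "y k B = z" by (auto simp: y_def B_def vec_eq_iff zk)
    have nz: "norm z = inverse (cmod (a $ k))"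
      by (simp add: z_def norm_vector_scalar_mult norm_inverse a)
    have ga: "g a = sgn (a $ k) ^ M *s g (z /\<^sub>R norm z)"
    proof -
      have "a = sgn (a $ k) *s (z /\<^sub>R norm z)"
        unfolding nz using k by (simp add: vec_eq_iff sgn_div_norm z_def)
      moreover have "z /\<^sub>R norm z \<noteq> 0" using zk by (auto simp: vec_eq_iff intro!: exI[of _ k])
      moreover have "cmod (sgn (a $ k)) = 1" using k by (simp add: norm_sgn)
      ultimately show ?thesis using equiv by metis
    qed
    have sg: "sgn (a $ k) ^ M = (a $ k) ^ M * of_real (norm z) ^ M"
      unfolding nz by (simp add: sgn_div_norm power_mult_distrib scaleR_conv_of_real)
    have "(a $ k) ^ M *s (of_real (norm z) ^ M *s g (z /\<^sub>R norm z) + (\<Sum>i\<in>UNIV. (z $ i) ^ M *s (A $ i))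
       + of_real s *s power_map M z) =
       g a + (\<Sum>i\<in>UNIV. (a $ i) ^ M *s (A $ i)) + complex_of_real s *s power_map M a"
    proof -
      have "(a $ k) ^ M *s (\<Sum>i\<in>UNIV. (z $ i) ^ M *s (A $ i)) = (\<Sum>i\<in>UNIV. (a $ i) ^ M *s (A $ i))"
        using k by (simp add: vec.scale_sum_right z_def vector_smult_assoc power_mult_distrib[symmetric] mult.assoc[symmetric])
      moreover have "power_map M a = (a $ k) ^ M *s power_map M z"
        by (subst az) (rule power_map_scale)
      ultimately show ?thesis
        unfolding ga sg by (simp add: vector_add_ldistrib vector_smult_assoc mult.commute)
    qed
    also have "\<dots> = 0" by (rule zero)
    finally have "of_real (norm z) ^ M *s g (z /\<^sub>R norm z) + (\<Sum>i\<in>UNIV. (z $ i) ^ M *s (A $ i))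
       + of_real s *s power_map M z = 0"
      using k by (simp only: vector_mul_eq_0 power_eq_0_iff simp_thms)
    moreover have "(\<Sum>i\<in>UNIV. (z $ i) ^ M *s (A $ i)) = A $ k + (\<Sum>i\<in>UNIV - {k}. (z $ i) ^ M *s (A $ i))"
      by (subst sum.remove[of _ k]) (auto simp: zk)
    moreover have "(\<Sum>i\<in>UNIV - {k}. (z $ i) ^ M *s (A $ i)) = (\<Sum>i\<in>UNIV - {k}. (z $ i) ^ M *s (B $ i))"
      by (rule sum.cong) (auto simp: B_def)
    moreover have "Re (B $ k $ k) = s" by (simp add: B_def)
    moreover have "x = - (v + p + r)" if "v + (x + r) + p = 0" for v x r p :: "complex ^ 'd"
      using that by (simp only: eq_neg_iff_add_eq_0 add_ac)
    ultimately have "A $ k = col k B"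
      unfolding col_def yB by simp
    then have "\<Psi> k B = A" by (auto simp: \<Psi>_def vec_eq_iff B_def)
    moreover have "B \<in> N k" by (simp add: N_def B_def)
    ultimately show ?thesis by blast
  qed
  have "\<not> negligible (ball (0 :: (complex ^ 'd) ^ 'd) e)"
    by (rule open_not_negligible) (use e in auto)
  then obtain A where A: "A \<in> ball 0 e" "A \<notin> (\<Union>k. \<Psi> k ` N k)"
    using negl negligible_subset by blast
  have "norm (A $ k) < e" for k
    using A(1) le_less_trans[OF Finite_Cartesian_Product.norm_nth_le] by auto
  then show ?thesis using A(2) bad by blast
qed

section \<open>Smooth equivariant maps on the sphere\<close>

definition circle_act :: "complex \<Rightarrow> (complex ^ 'd) \<times> complex \<Rightarrow> (complex ^ 'd) \<times> complex" where
  "circle_act l x = (l *s fst x, l * snd x)"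

text \<open>
  Suppose that there is no zero.  After a generic perturbation, which is too small to create zeros,
  a zero-free map \<open>H\<close> on the ball of radius \<open>2\<close> is built from two pieces.  For \<open>norm a \<le> 1\<close> it
  runs over the hemisphere, parametrised by \<open>(a, \<tau> a)\<close> up to normalisation.  For \<open>norm a\<close> between \<open>1\<close> and
  \<open>2\<close> it follows the straight-line homotopy from the equator to the power map, with parameter \<open>\<sigma> a\<close>.
\<close>

lemma c1_equivariant_zero:
  fixes F :: "(complex ^ 'd) \<times> complex \<Rightarrow> complex ^ 'd"
  assumes F: "c1_on UNIV F"
    and equiv: "\<And>l x. cmod l = 1 \<Longrightarrow> F (circle_act l x) = l ^ M *s F x"
    and M: "M > 0"
  shows "\<exists>x\<in>sphere 0 1. F x = 0"
proof (rule ccontr)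
  assume no: "\<not> ?thesis"
  have "continuous_on (sphere 0 1) (\<lambda>x. norm (F x))"
    using c1_on_imp_continuous_on[OF c1_on_subset[OF F]] by (intro continuous_intros) auto
  moreover have "sphere (0 :: (complex ^ 'd) \<times> complex) 1 \<noteq> {}" by simp
  ultimately obtain x0 where x0: "x0 \<in> sphere 0 1" "\<And>x. x \<in> sphere 0 1 \<Longrightarrow> norm (F x0) \<le> norm (F x)"
    using continuous_attains_inf[OF compact_sphere] by metis
  define \<delta> where "\<delta> = norm (F x0)"
  have \<delta>: "\<delta> > 0" using no x0 by (auto simp: \<delta>_def)
  define g where "g a = F (a /\<^sub>R norm a, 0)" for a
  have g_c1: "c1_on (- {0}) g"
    unfolding g_def[abs_def]
    by (rule c1_on_compose[OF F c1_on_Pair[OF c1_on_normalize(2)[OF c1_on_ident] c1_on_const]]) auto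
  have g_equiv: "g (l *s x) = l ^ M *s g x" if "cmod l = 1" for l x
  proof -
    have "(l *s x /\<^sub>R norm (l *s x), 0) = circle_act l (x /\<^sub>R norm x, 0)"
      by (simp add: circle_act_def norm_vector_scalar_mult that vec_eq_iff)
    then show ?thesis by (simp add: g_def equiv that)
  qed
  have "\<delta> / CARD('d) > 0" using \<delta> by simp
  from generic_perturbation[OF g_c1 g_equiv this]
  obtain A :: "(complex ^ 'd) ^ 'd" where A: "\<And>k. norm (A $ k) < \<delta> / CARD('d)"
    "\<And>a s. norm a = 1 \<Longrightarrow> g a + (\<Sum>k\<in>UNIV. (a $ k) ^ M *s (A $ k)) + complex_of_real s *s power_map M a \<noteq> 0"
    by blast
  define G where "G x = F x + (\<Sum>k\<in>UNIV. (fst x $ k) ^ M *s (A $ k))" for x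
  have G_c1: "c1_on UNIV G"
    unfolding G_def[abs_def]
    by (intro c1_on_add c1_on_sum c1_on_vector_scalar_mult c1_on_power c1_on_vec_nth c1_on_const F
        c1_on_linear[OF bounded_linear_fst]) auto
  have G_nz: "G x \<noteq> 0" if x: "norm x = 1" for x
  proof -
    have "norm (\<Sum>k\<in>UNIV. (fst x $ k) ^ M *s (A $ k)) \<le> (\<Sum>k\<in>UNIV. norm (A $ k))"
    proof (rule sum_norm_le)
      fix k
      have "cmod (fst x $ k) \<le> norm (fst x)" by (rule Finite_Cartesian_Product.norm_nth_le)
      also have "\<dots> \<le> 1" using norm_fst_le[of "fst x" "snd x"] x by simp
      finally show "norm ((fst x $ k) ^ M *s (A $ k)) \<le> norm (A $ k)"
        by (simp add: norm_vector_scalar_mult norm_power mult_left_le_one_le power_le_one)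
    qed
    also have "\<dots> < (\<Sum>k\<in>(UNIV :: 'd set). \<delta> / CARD('d))"
      by (rule sum_strict_mono) (use A(1) in auto)
    also have "\<dots> = \<delta>" by simp
    also have "\<delta> \<le> norm (F x)" unfolding \<delta>_def using x0(2)[of x] x by simp
    finally show ?thesis unfolding G_def by (metis add_eq_0_iff less_irrefl norm_minus_cancel)
  qed
  define \<tau> where "\<tau> a = (max 0 (1 - a \<bullet> a))\<^sup>2" for a :: "complex ^ 'd"
  define \<sigma> where "\<sigma> a = (max 0 (a \<bullet> a - 1))\<^sup>2 / 9" for a :: "complex ^ 'd"
  define p where "p a = (a, complex_of_real (\<tau> a))" for a :: "complex ^ 'd"
  define H where "H a = (1 - \<sigma> a) *\<^sub>R G (p a /\<^sub>R norm (p a)) + \<sigma> a *\<^sub>R power_map M a" for a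
  have \<tau>_c1: "c1_on UNIV \<tau>"
    unfolding \<tau>_def[abs_def] diff_conv_add_uminus
    by (intro c1_on_compose[OF c1_on_max_square] c1_on_add c1_on_const c1_on_inner c1_on_ident
        c1_on_bounded_linear[OF bounded_linear_minus[OF bounded_linear_ident]]) auto
  have \<sigma>_c1: "c1_on UNIV \<sigma>"
    unfolding \<sigma>_def[abs_def] diff_conv_add_uminus
    by (intro c1_on_bounded_linear[OF bounded_linear_divide] c1_on_compose[OF c1_on_max_square] c1_on_add
        c1_on_const c1_on_inner c1_on_ident) auto
  have p_nz: "p a \<noteq> 0" for a
    by (cases "a = 0") (auto simp: p_def \<tau>_def zero_prod_def)
  have p_c1: "c1_on UNIV p"
    unfolding p_def[abs_def] by (intro c1_on_Pair c1_on_ident c1_on_bounded_linear[OF bounded_linear_of_real] \<tau>_c1)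
  have H_c1: "c1_on UNIV H"
    unfolding H_def[abs_def] diff_conv_add_uminus power_map_def
    by (intro c1_on_add c1_on_scaleR c1_on_const \<sigma>_c1 c1_on_compose[OF G_c1 c1_on_normalize(2)[OF p_c1 p_nz]]
        c1_on_bounded_linear[OF bounded_linear_minus[OF bounded_linear_ident]]
        c1_on_vec_lambda c1_on_power c1_on_vec_nth c1_on_ident) auto
  have "\<exists>x\<in>cball 0 2. H x = 0"
  proof (rule power_map_zero_if_eq_on_sphere[OF c1_on_subset[OF H_c1] _ M])
    fix a :: "complex ^ 'd" assume "a \<in> sphere 0 2"
    then have "a \<bullet> a = 4" by (simp add: dot_square_norm)
    then show "H a = power_map M a" by (simp add: H_def \<sigma>_def)
  qed auto
  then obtain a where a: "norm a \<le> 2" "H a = 0" by auto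
  show False
  proof (cases "norm a \<le> 1")
    case True
    then have "a \<bullet> a \<le> 1" by (simp add: dot_square_norm power_le_one)
    then have "H a = G (p a /\<^sub>R norm (p a))" by (simp add: H_def \<sigma>_def)
    with a(2) show False using G_nz[of "p a /\<^sub>R norm (p a)"] p_nz[of a] by simp
  next
    case False
    define u where "u = a /\<^sub>R norm a"
    have "norm a \<noteq> 0" using False by linarith
    then have u: "norm u = 1" and au': "a = norm a *\<^sub>R u" by (simp_all add: u_def)
    have au: "a = of_real (norm a) *s u"
      by (subst au') (rule scaleR_eq_vector_scalar_mult)
    have aa: "a \<bullet> a > 1" using False by (simp add: dot_square_norm)
    have pa: "p a /\<^sub>R norm (p a) = (u, 0)"
      using aa by (simp add: p_def \<tau>_def u_def norm_Pair)
    have Gu: "G (u, 0) = g u + (\<Sum>k\<in>UNIV. (u $ k) ^ M *s (A $ k))"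
      using u by (simp add: G_def g_def)
    show False
    proof (cases "\<sigma> a = 1")
      case True
      then have "power_map M a = 0" using a(2) by (simp add: H_def)
      then show False using False M by (auto simp: power_map_eq_0_iff)
    next
      case False
      \<comment> \<open>Up to a nonzero factor, \<open>H a\<close> has the form that the generic choice of \<open>A\<close> excludes as a zero.\<close>
      define s where "s = \<sigma> a * norm a ^ M / (1 - \<sigma> a)"
      have "power_map M a = of_real (norm a ^ M) *s power_map M u"
        by (subst au) (simp add: power_map_scale)
      then have "H a = of_real (1 - \<sigma> a) *s (G (u, 0) + of_real s *s power_map M u)"
        using False unfolding H_def pa scaleR_eq_vector_scalar_mult
        by (simp add: s_def vector_add_ldistrib vector_smult_assoc)
      then have "of_real (1 - \<sigma> a) *s (G (u, 0) + of_real s *s power_map M u) = 0"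
        unfolding a(2) by (rule sym)
      then have "G (u, 0) + of_real s *s power_map M u = 0"
        using False unfolding vector_mul_eq_0 of_real_eq_0_iff by auto
      then show False using A(2)[OF u, of s] Gu by simp
    qed
  qed
qed

section \<open>The Borsuk-Ulam theorem for circle actions\<close>

text \<open>
  Finite sums of smooth functions each of which is multiplied by a fixed integer power of \<open>l\<close>
  when the unit number \<open>l\<close> acts on the argument.
\<close>

inductive trig_poly :: "((complex ^ 'd) \<times> complex \<Rightarrow> complex) \<Rightarrow> bool" where
  pure: "c1_on UNIV g \<Longrightarrow> (\<And>l x. cmod l = 1 \<Longrightarrow> g (circle_act l x) = l powi k * g x) \<Longrightarrow> trig_poly g"
| add: "trig_poly f \<Longrightarrow> trig_poly g \<Longrightarrow> trig_poly (\<lambda>x. f x + g x)"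

lemma trig_poly_mult:
  assumes "trig_poly f" "trig_poly g"
  shows "trig_poly (\<lambda>x. f x * g x)"
  using assms(1)
proof induction
  case (pure f k)
  note f = pure
  from assms(2) show ?case
  proof induction
    case (pure g k')
    show ?case
    proof (rule trig_poly.pure)
      show "c1_on UNIV (\<lambda>x. f x * g x)" by (intro c1_on_mult f pure)
      fix l :: complex and x assume l: "cmod l = 1"
      then have "l \<noteq> 0" by auto
      then show "f (circle_act l x) * g (circle_act l x) = l powi (k + k') * (f x * g x)"
        using l by (simp add: f pure power_int_add)
    qed
  next
    case (add g h)
    then show ?case using trig_poly.add by (simp add: distrib_left)
  qed
next
  case (add f h)
  then show ?case using trig_poly.add by (simp add: distrib_right)
qed

lemma trig_poly_const: "trig_poly (\<lambda>x. c)"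
  by (rule trig_poly.pure[where k=0]) (auto intro: c1_on_const)

lemma circle_act_eq: "circle_act l x = Re l *\<^sub>R x + Im l *\<^sub>R circle_act \<i> x"
  by (cases x) (simp add: circle_act_def vec_eq_iff complex_eq_iff)

lemma norm_circle_act: "cmod l = 1 \<Longrightarrow> norm (circle_act l x) = norm x"
  by (simp add: circle_act_def norm_Pair norm_vector_scalar_mult norm_mult norm_prod_def)

lemma bounded_linear_circle_act: "bounded_linear (circle_act l :: _ \<Rightarrow> (complex ^ 'd) \<times> complex)"
  unfolding linear_conv_bounded_linear[symmetric]
  by (rule linearI) (simp_all add: circle_act_def vec_eq_iff algebra_simps)

text \<open>
  A real linear form is the sum of a complex linear and a complex antilinear one, of weights \<open>1\<close>
  and \<open>-1\<close>.
\<close>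

lemma trig_poly_linear:
  fixes f :: "(complex ^ 'd) \<times> complex \<Rightarrow> real"
  assumes f: "bounded_linear f"
  shows "trig_poly (\<lambda>x. complex_of_real (f x))"
proof -
  interpret f: bounded_linear f by (rule f)
  define J where "J x = circle_act \<i> x" for x :: "(complex ^ 'd) \<times> complex"
  define u where "u x = (complex_of_real (f x) - \<i> * of_real (f (J x))) / 2" for x
  define v where "v x = (complex_of_real (f x) + \<i> * of_real (f (J x))) / 2" for x
  have JJ: "J (J x) = - x" for x by (cases x) (simp add: J_def circle_act_def vec_eq_iff)
  have J: "bounded_linear J" unfolding J_def[abs_def] by (rule bounded_linear_circle_act)
  have c1: "c1_on UNIV (\<lambda>x. complex_of_real (f x))" "c1_on UNIV (\<lambda>x. complex_of_real (f (J x)))"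
    by (intro c1_on_bounded_linear[OF bounded_linear_of_real] c1_on_bounded_linear[OF f] c1_on_linear J f)+
  have f1: "f (circle_act l x) = Re l * f x + Im l * f (J x)" for l x
    by (subst circle_act_eq) (simp add: f.add f.scaleR J_def)
  have f2: "f (J (circle_act l x)) = Re l * f (J x) - Im l * f x" for l x
    by (subst circle_act_eq)
       (simp add: J[THEN bounded_linear.linear, THEN linear_add] J[THEN bounded_linear.linear, THEN linear_cmul]
         JJ f.add f.diff f.scaleR flip: J_def)
  have "trig_poly u"
  proof (rule trig_poly.pure[where k=1])
    show "c1_on UNIV u" unfolding u_def[abs_def] diff_conv_add_uminus
      by (intro c1_on_bounded_linear[OF bounded_linear_divide] c1_on_add c1_on_mult c1_on_const c1
        c1_on_bounded_linear[OF bounded_linear_minus[OF bounded_linear_ident]])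
    show "u (circle_act l x) = l powi 1 * u x" for l x
      unfolding u_def f1 f2 by (simp add: complex_eq_iff algebra_simps)
  qed
  moreover have "trig_poly v"
  proof (rule trig_poly.pure[where k="-1"])
    show "c1_on UNIV v" unfolding v_def[abs_def]
      by (intro c1_on_bounded_linear[OF bounded_linear_divide] c1_on_add c1_on_mult c1_on_const c1)
    show "v (circle_act l x) = l powi (-1) * v x" if "cmod l = 1" for l x
    proof -
      have "v (circle_act l x) = cnj l * v x"
        unfolding v_def f1 f2 by (simp add: complex_eq_iff algebra_simps)
      moreover have "l * cnj l = 1" using that by (simp flip: complex_norm_square)
      then have "cnj l = inverse l" by (rule inverse_unique[symmetric])
      ultimately show ?thesis by (simp add: power_int_minus)
    qed
  qed
  moreover have "(\<lambda>x. complex_of_real (f x)) = (\<lambda>x. u x + v x)"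
    by (auto simp: u_def v_def field_simps)
  ultimately show ?thesis using trig_poly.add by metis
qed

lemma trig_poly_real_polynomial_function:
  "real_polynomial_function p \<Longrightarrow> trig_poly (\<lambda>x. complex_of_real (p x))"
proof (induction p rule: real_polynomial_function.induct)
  case (linear f)
  then show ?case by (rule trig_poly_linear)
qed (auto intro: trig_poly_const trig_poly.add trig_poly_mult)

lemma trig_poly_polynomial_function:
  assumes "polynomial_function p"
  shows "trig_poly p"
proof -
  have "trig_poly (\<lambda>x. complex_of_real (Re (p x)))" "trig_poly (\<lambda>x. complex_of_real (Im (p x)))"
    using assms bounded_linear_Re bounded_linear_Im unfolding polynomial_function_def
    by (auto intro!: trig_poly_real_polynomial_function simp: o_def)
  then have "trig_poly (\<lambda>x. complex_of_real (Re (p x)) + \<i> * complex_of_real (Im (p x)))"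
    by (intro trig_poly.add trig_poly_mult trig_poly_const)
  then show ?thesis by (simp flip: complex_eq)
qed

text \<open>
  Averaging against the \<open>N\<close>-th roots of unity, instead of the whole circle, picks out the weights
  congruent to \<open>M\<close> modulo \<open>N\<close>; for a given finite sum and large \<open>N\<close> only the weight \<open>M\<close> survives.
\<close>

definition weight_average :: "nat \<Rightarrow> nat \<Rightarrow> ((complex ^ 'd) \<times> complex \<Rightarrow> complex) \<Rightarrow> (complex ^ 'd) \<times> complex \<Rightarrow> complex" where
  "weight_average M N f x =
     (\<Sum>j<N. cnj (cis (2 * pi * real j / real N)) ^ M * f (circle_act (cis (2 * pi * real j / real N)) x)) / of_nat N"

text \<open>
  The average is a geometric sum in \<open>\<zeta> = exp (2\<pi>\<i> (k - M) / N)\<close>, which is \<open>1\<close> only if \<open>N\<close> divides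
  \<open>k - M\<close>.
\<close>

lemma weight_average_pure:
  assumes g: "\<And>l x. cmod l = 1 \<Longrightarrow> g (circle_act l x) = l powi k * g x"
    and N: "N > nat \<bar>k - int M\<bar>"
  shows "weight_average M N g x = (if k = int M then g x else 0)"
proof -
  define \<zeta> where "\<zeta> = cis (2 * pi * real_of_int (k - int M) / real N)"
  have summand: "cnj (cis (2 * pi * real j / real N)) ^ M * g (circle_act (cis (2 * pi * real j / real N)) x) = \<zeta> ^ j * g x" for j
  proof -
    let ?c = "cis (2 * pi * real j / real N)"
    have "cnj ?c ^ M * ?c powi k = cis (real M * - (2 * pi * real j / real N)) * cis (real_of_int k * (2 * pi * real j / real N))"
      by (simp add: cis_cnj Complex.DeMoivre cis_power_int)
    also have "\<dots> = cis (real j * (2 * pi * real_of_int (k - int M) / real N))"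
      unfolding cis_mult by (rule arg_cong[where f=cis]) (simp add: field_simps diff_divide_distrib)
    also have "\<dots> = \<zeta> ^ j" by (simp only: \<zeta>_def Complex.DeMoivre)
    finally show ?thesis by (simp add: g)
  qed
  have "(\<Sum>j<N. \<zeta> ^ j) = (if k = int M then of_nat N else 0)"
  proof (cases "k = int M")
    case False
    have "\<zeta> \<noteq> 1"
    proof
      assume "\<zeta> = 1"
      then obtain n :: int where "2 * pi * real_of_int (k - int M) / real N = of_int (2 * n) * pi"
        unfolding \<zeta>_def cis_conv_exp exp_eq_1 by auto
      then have "(2 * pi) * (real_of_int (k - int M) / real N) = (2 * pi) * of_int n"
        by (simp add: mult_ac)
      then have "real_of_int (k - int M) / real N = of_int n"
        by (subst (asm) mult_left_cancel) auto
      then have "real_of_int (k - int M) = real_of_int (n * int N)"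
        using N by (simp add: field_simps)
      then have "k - int M = n * int N" by linarith
      moreover from this False have "n \<noteq> 0" by (metis mult_zero_left right_minus_eq)
      then have "\<bar>n\<bar> \<ge> 1" by linarith
      then have "\<bar>n\<bar> * int N \<ge> 1 * int N" by (intro mult_right_mono) auto
      ultimately have "\<bar>k - int M\<bar> \<ge> int N" by (simp add: abs_mult)
      then show False using N by linarith
    qed
    moreover have "\<zeta> ^ N = 1"
    proof -
      have "\<zeta> ^ N = cis (2 * pi * real_of_int (k - int M))"
        using N by (simp add: \<zeta>_def Complex.DeMoivre)
      also have "\<dots> = 1"
        by (rule cis_multiple_2pi) auto
      finally show ?thesis .
    qed
    ultimately show ?thesis using False by (simp add: geometric_sum)
  qed (simp add: \<zeta>_def)
  then have "(\<Sum>j<N. \<zeta> ^ j * g x) = (if k = int M then of_nat N else 0) * g x"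
    by (simp add: sum_distrib_right[symmetric])
  then show ?thesis
    using N by (simp add: weight_average_def summand)
qed

lemma weight_average_trig_poly:
  assumes "trig_poly p"
  shows "\<exists>g D. c1_on UNIV g \<and> (\<forall>l x. cmod l = 1 \<longrightarrow> g (circle_act l x) = l ^ M * g x) \<and>
    (\<forall>N>D. weight_average M N p = g)"
  using assms
proof induction
  case (pure g k)
  show ?case
  proof (intro exI conjI allI impI)
    show "weight_average M N g = (\<lambda>x. if k = int M then g x else 0)" if "N > nat \<bar>k - int M\<bar>" for N
      using weight_average_pure[OF pure(2) that] by auto
    show "c1_on UNIV (\<lambda>x. if k = int M then g x else 0)"
      using pure(1) by (cases "k = int M") (auto intro: c1_on_const)
    show "(if k = int M then g (circle_act l x) else 0) = l ^ M * (if k = int M then g x else 0)" if "cmod l = 1" for l x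
      using pure(2)[OF that] by (simp add: power_int_of_nat)
  qed
next
  case (add f g)
  obtain f' D where f': "c1_on UNIV f'" "\<And>l x. cmod l = 1 \<Longrightarrow> f' (circle_act l x) = l ^ M * f' x"
    "\<And>N. N > D \<Longrightarrow> weight_average M N f = f'" using add.IH(1) by blast
  obtain g' E where g': "c1_on UNIV g'" "\<And>l x. cmod l = 1 \<Longrightarrow> g' (circle_act l x) = l ^ M * g' x"
    "\<And>N. N > E \<Longrightarrow> weight_average M N g = g'" using add.IH(2) by blast
  have "weight_average M N (\<lambda>x. f x + g x) = (\<lambda>x. f' x + g' x)" if "N > max D E" for N
  proof
    fix x
    have "weight_average M N (\<lambda>x. f x + g x) x = weight_average M N f x + weight_average M N g x"
      by (simp add: weight_average_def distrib_left sum.distrib add_divide_distrib)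
    then show "weight_average M N (\<lambda>x. f x + g x) x = f' x + g' x"
      using f'(3) g'(3) that by simp
  qed
  then show ?case
    using f'(1,2) g'(1,2) by (intro exI[of _ "\<lambda>x. f' x + g' x"] exI[of _ "max D E"])
      (auto intro: c1_on_add simp: distrib_left)
qed

text \<open>
  A polynomial approximation of \<open>f\<close> is averaged.  The average of \<open>f\<close> is \<open>f\<close> itself, so averaging does not
  increase the error.
\<close>

lemma c1_equivariant_approximation:
  fixes f :: "(complex ^ 'd) \<times> complex \<Rightarrow> complex"
  assumes cont: "continuous_on (sphere 0 1) f"
    and equiv: "\<And>l x. cmod l = 1 \<Longrightarrow> x \<in> sphere 0 1 \<Longrightarrow> f (circle_act l x) = l ^ M * f x"
    and e: "e > 0"
  shows "\<exists>g. c1_on UNIV g \<and> (\<forall>l x. cmod l = 1 \<longrightarrow> g (circle_act l x) = l ^ M * g x) \<and>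
    (\<forall>x\<in>sphere 0 1. cmod (f x - g x) < e)"
proof -
  obtain p where p: "polynomial_function p" "\<And>x. x \<in> sphere 0 1 \<Longrightarrow> norm (f x - p x) < e"
    using Stone_Weierstrass_polynomial_function[OF compact_sphere cont e] by blast
  obtain g D where g: "c1_on UNIV g" "\<And>l x. cmod l = 1 \<Longrightarrow> g (circle_act l x) = l ^ M * g x"
    "\<And>N. N > D \<Longrightarrow> weight_average M N p = g"
    using weight_average_trig_poly[OF trig_poly_polynomial_function[OF p(1)]] by blast
  have "cmod (f x - g x) < e" if x: "x \<in> sphere 0 1" for x
  proof -
    define N where "N = Suc D"
    define c where "c j = cis (2 * pi * real j / real N)" for j
    have "f x = (\<Sum>j<N. cnj (c j) ^ M * f (circle_act (c j) x)) / of_nat N"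
    proof -
      have "cnj (c j) ^ M * f (circle_act (c j) x) = f x" for j
      proof -
        have "cnj (c j) * c j = 1" by (simp add: c_def cis_cnj cis_mult)
        then have "cnj (c j) ^ M * c j ^ M = 1" by (metis power_mult_distrib power_one)
        then show ?thesis using x by (simp add: equiv c_def mult.assoc[symmetric])
      qed
      then show ?thesis by (simp add: N_def del: of_nat_Suc)
    qed
    moreover have "g x = (\<Sum>j<N. cnj (c j) ^ M * p (circle_act (c j) x)) / of_nat N"
      using g(3)[of N] by (auto simp: weight_average_def N_def c_def)
    ultimately have "f x - g x = (\<Sum>j<N. cnj (c j) ^ M * (f (circle_act (c j) x) - p (circle_act (c j) x))) / of_nat N"
      by (simp add: right_diff_distrib sum_subtractf diff_divide_distrib)
    then have eq: "cmod (f x - g x) =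
        cmod (\<Sum>j<N. cnj (c j) ^ M * (f (circle_act (c j) x) - p (circle_act (c j) x))) / real N"
      by (simp add: norm_divide)
    have "cmod (\<Sum>j<N. cnj (c j) ^ M * (f (circle_act (c j) x) - p (circle_act (c j) x)))
       \<le> (\<Sum>j<N. cmod (f (circle_act (c j) x) - p (circle_act (c j) x)))"
      by (rule sum_norm_le) (simp add: norm_mult norm_power c_def)
    also have "\<dots> < (\<Sum>j<N. e)"
      by (rule sum_strict_mono) (use x in \<open>auto intro!: p(2) simp: N_def norm_circle_act c_def\<close>)
    also have "\<dots> = e * real N" by simp
    finally show ?thesis
      unfolding eq by (subst pos_divide_less_eq) (auto simp: N_def)
  qed
  with g show ?thesis by blast
qed

text \<open>
  Replacing \<open>f i\<close> by a suitable power gives all components the common weight \<open>M\<close>, the product of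
  the \<open>m i\<close>, and does not change the zeros.
\<close>

theorem circle_Borsuk_Ulam:
  fixes f :: "'d::finite \<Rightarrow> (complex ^ 'd) \<times> complex \<Rightarrow> complex"
  assumes cont: "\<And>i. continuous_on (sphere 0 1) (f i)"
    and equiv: "\<And>i l x. cmod l = 1 \<Longrightarrow> x \<in> sphere 0 1 \<Longrightarrow> f i (circle_act l x) = l ^ m i * f i x"
    and m: "\<And>i. m i > 0"
  shows "\<exists>x\<in>sphere 0 1. \<forall>i. f i x = 0"
proof (rule ccontr)
  assume no: "\<not> ?thesis"
  define M where "M = (\<Prod>i\<in>UNIV. m i)"
  have M: "M > 0" using m by (auto simp: M_def intro!: prod_pos)
  have Mm: "m i * (M div m i) = M" for i
    by (rule dvd_mult_div_cancel) (auto simp: M_def)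
  define h where "h x = (\<chi> i. f i x ^ (M div m i))" for x
  have h_nz: "h x \<noteq> 0" if x: "x \<in> sphere 0 1" for x
  proof -
    obtain i where "f i x \<noteq> 0" using no x by blast
    then show ?thesis by (auto simp: h_def vec_eq_iff intro!: exI[of _ i])
  qed
  have h_cont: "continuous_on (sphere 0 1) (\<lambda>x. h x $ i)" for i
    unfolding h_def by (simp, intro continuous_intros cont)
  have h_equiv: "h (circle_act l x) $ i = l ^ M * h x $ i" if "cmod l = 1" "x \<in> sphere 0 1" for l x i
    using that by (simp add: h_def equiv power_mult_distrib power_mult[symmetric] Mm)
  have "continuous_on (sphere 0 1) h"
    unfolding h_def by (intro continuous_on_vec_lambda continuous_intros cont)
  then have "continuous_on (sphere 0 1) (\<lambda>x. norm (h x))" by (intro continuous_intros)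
  moreover have "sphere (0 :: (complex ^ 'd) \<times> complex) 1 \<noteq> {}" by simp
  ultimately obtain x0 where x0: "x0 \<in> sphere 0 1" "\<And>x. x \<in> sphere 0 1 \<Longrightarrow> norm (h x0) \<le> norm (h x)"
    using continuous_attains_inf[OF compact_sphere] by metis
  define \<delta> where "\<delta> = norm (h x0) / CARD('d)"
  have \<delta>: "\<delta> > 0" using h_nz x0 by (auto simp: \<delta>_def)
  have "\<exists>g. c1_on UNIV g \<and> (\<forall>l x. cmod l = 1 \<longrightarrow> g (circle_act l x) = l ^ M * g x) \<and>
    (\<forall>x\<in>sphere 0 1. cmod (h x $ i - g x) < \<delta>)" for i
    by (rule c1_equivariant_approximation[OF h_cont h_equiv \<delta>])
  then obtain g where g: "\<And>i. c1_on UNIV (g i)" "\<And>i l x. cmod l = 1 \<Longrightarrow> g i (circle_act l x) = l ^ M * g i x"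
    "\<And>i x. x \<in> sphere 0 1 \<Longrightarrow> cmod (h x $ i - g i x) < \<delta>"
    by metis
  have "\<exists>x\<in>sphere 0 1. (\<chi> i. g i x) = 0"
    by (rule c1_equivariant_zero[OF c1_on_vec_lambda _ M]) (auto simp: g vec_eq_iff)
  then obtain x where x: "x \<in> sphere 0 1" "\<And>i. g i x = 0" by (auto simp: vec_eq_iff)
  have "norm (h x) \<le> (\<Sum>i\<in>UNIV. cmod (h x $ i))"
    by (simp add: norm_vec_def L2_set_le_sum)
  also have "\<dots> < (\<Sum>i\<in>(UNIV :: 'd set). \<delta>)"
    using g(3)[OF x(1)] by (intro sum_strict_mono) (auto simp: x(2))
  also have "\<dots> = norm (h x0)" by (simp add: \<delta>_def)
  also have "\<dots> \<le> norm (h x)" by (rule x0(2)[OF x(1)])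
  finally show False by simp
qed

section \<open>Complex hyperplanes and the circle measure\<close>

text \<open>
  The kernel of a nonzero linear form together with \<open>a\<close>, on which the form does not vanish, spans the whole
  space.
\<close>

lemma complex_hyperplane_equation:
  fixes a :: "complex ^ 'd"
  assumes a: "a \<noteq> 0"
  shows "complex_hyperplane {u. cinner_vec u a + c = 0}"
proof -
  have add: "cinner_vec (u + v) a = cinner_vec u a + cinner_vec v a" for u v
    by (simp add: cinner_vec_def distrib_right sum.distrib)
  have scale: "cinner_vec (k *s u) a = k * cinner_vec u a" for k u
    by (simp add: cinner_vec_def sum_distrib_left mult.assoc)
  have aa: "cinner_vec a a \<noteq> 0"
  proof
    assume "cinner_vec a a = 0"
    moreover have "cinner_vec a a = complex_of_real (\<Sum>i\<in>UNIV. (cmod (a $ i))\<^sup>2)"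
      by (simp only: cinner_vec_def complex_norm_square of_real_sum)
    ultimately have "complex_of_real (\<Sum>i\<in>UNIV. (cmod (a $ i))\<^sup>2) = 0" by simp
    then have "(\<Sum>i\<in>UNIV. (cmod (a $ i))\<^sup>2) = 0" by (simp only: of_real_eq_0_iff)
    then show False using a by (simp add: sum_nonneg_eq_0_iff vec_eq_iff)
  qed
  define V where "V = {u. cinner_vec u a = 0}"
  define p where "p = (- c / cinner_vec a a) *s a"
  have sub: "vec.subspace V"
    unfolding vec.subspace_def V_def by (auto simp: add scale) (simp add: cinner_vec_def)
  have "vec.span (insert a V) = UNIV"
  proof (rule UNIV_eq_I[symmetric])
    fix u
    define k where "k = cinner_vec u a / cinner_vec a a"
    have "cinner_vec (u - k *s a) a + cinner_vec (k *s a) a = cinner_vec u a"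
      by (simp flip: add)
    then have "u - k *s a \<in> V" using aa by (simp add: V_def scale k_def)
    then have "u - k *s a + k *s a \<in> vec.span (insert a V)"
      by (intro vec.span_add vec.span_scale) (auto intro: vec.span_base)
    then show "u \<in> vec.span (insert a V)" by simp
  qed
  then have "vec.dim (insert a V) = CARD('d)"
    using vec.dim_span[of "insert a V"] vec_dim_card[where 'a=complex and 'n='d] by simp
  moreover have "a \<notin> vec.span V"
    using sub aa by (simp add: vec.span_eq_iff[THEN iffD2] V_def)
  ultimately have dim: "vec.dim V + 1 = CARD('d)"
    by (simp add: vec.dim_insert)
  have cp: "cinner_vec p a = - c" unfolding p_def scale using aa by simp
  have "{u. cinner_vec u a + c = 0} = (\<lambda>v. p + v) ` V"
  proof (intro set_eqI iffI)
    fix u assume u: "u \<in> {u. cinner_vec u a + c = 0}"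
    have "cinner_vec p a + cinner_vec (u - p) a = cinner_vec u a" by (simp flip: add)
    then have "cinner_vec (u - p) a = cinner_vec u a + c" unfolding cp by (auto simp: algebra_simps)
    then have "u - p \<in> V" using u by (simp add: V_def)
    then show "u \<in> (\<lambda>v. p + v) ` V" by (rule rev_image_eqI) simp
  qed (auto simp: V_def add cp)
  with sub dim show ?thesis unfolding complex_hyperplane_def by blast
qed

lemma measurable_cis: "cis \<in> borel_measurable borel"
  by (intro borel_measurable_continuous_onI continuous_intros)

lemma emeasure_interval_2pi: "emeasure lborel {0..2 * pi} = ennreal (2 * pi)"
  by simp

lemma measurable_cis_circle:
  "cis \<in> measurable (uniform_measure lborel {0..2 * pi}) (restrict_space borel (sphere 0 1))"
proof (rule measurable_restrict_space2)
  have "sets (uniform_measure lborel {0..2 * pi}) = sets borel" by simp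
  from measurable_cong_sets[OF this refl] show "cis \<in> borel_measurable (uniform_measure lborel {0..2 * pi})"
    using measurable_cis by blast
qed auto

lemma finite_measure_circle_measure: "finite_measure circle_measure"
proof -
  have "emeasure (uniform_measure lborel {0..2 * pi}) (space (uniform_measure lborel {0..2 * pi})) \<noteq> \<infinity>"
    by (simp add: emeasure_uniform_measure ennreal_divide_eq_top_iff)
  then show ?thesis
    unfolding circle_measure_def
    by (intro finite_measure.finite_measure_distr finite_measureI measurable_cis_circle)
qed

lemma sets_circle_measure [measurable_cong]: "sets circle_measure = sets (restrict_space borel (sphere 0 1))"
  by (simp add: circle_measure_def)

lemma space_circle_measure: "space circle_measure = sphere 0 1"
  by (simp add: circle_measure_def space_restrict_space)

lemma borel_measurable_circle: "f \<in> borel_measurable borel \<Longrightarrow> f \<in> borel_measurable circle_measure"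
  by (simp add: measurable_cong_sets[OF sets_circle_measure refl] measurable_restrict_space1)

lemma integral_circle_measure:
  fixes f :: "complex \<Rightarrow> complex"
  assumes f[measurable]: "f \<in> borel_measurable borel"
  shows "(\<integral>l. f l \<partial>circle_measure) = (\<integral>t. indicator {0..2 * pi} t *\<^sub>R f (cis t) \<partial>lborel) /\<^sub>R (2 * pi)"
proof -
  note measurable_cis[measurable]
  have "(\<integral>l. f l \<partial>circle_measure) = (\<integral>t. f (cis t) \<partial>uniform_measure lborel {0..2 * pi})"
    unfolding circle_measure_def
    by (rule integral_distr[OF measurable_cis_circle]) (simp add: measurable_restrict_space1)
  also have "uniform_measure lborel {0..2 * pi} = density lborel (\<lambda>t. ennreal (indicator {0..2 * pi} t / (2 * pi)))"
    unfolding uniform_measure_def emeasure_interval_2pi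
    by (intro arg_cong2[where f=density] refl ext)
       (auto simp: indicator_def divide_ennreal[symmetric] ennreal_1[symmetric] simp del: ennreal_1)
  also have "(\<integral>t. f (cis t) \<partial>\<dots>) = (\<integral>t. (indicator {0..2 * pi} t / (2 * pi)) *\<^sub>R f (cis t) \<partial>lborel)"
    by (rule integral_density) auto
  also have "\<dots> = (\<integral>t. (indicator {0..2 * pi} t *\<^sub>R f (cis t)) /\<^sub>R (2 * pi) \<partial>lborel)"
  proof (rule Bochner_Integration.integral_cong[OF refl])
    fix t
    show "(indicator {0..2 * pi} t / (2 * pi)) *\<^sub>R f (cis t) = (indicator {0..2 * pi} t *\<^sub>R f (cis t)) /\<^sub>R (2 * pi)"
      by (simp only: divide_inverse scaleR_scaleR mult.commute)
  qed
  finally show ?thesis by (simp only: integral_scaleR_right)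
qed

text \<open>
  In terms of the angle, the part of the shifted interval \<open>[s, s + 2\<pi>]\<close> beyond \<open>2\<pi>\<close> is moved back by
  one period.
\<close>

lemma circle_measure_rotate:
  fixes f :: "complex \<Rightarrow> complex"
  assumes f[measurable]: "f \<in> borel_measurable borel" and bound: "\<And>l. cmod l = 1 \<Longrightarrow> cmod (f l) \<le> B" and k: "cmod k = 1"
  shows "(\<integral>l. f (k * l) \<partial>circle_measure) = (\<integral>l. f l \<partial>circle_measure)"
proof -
  note measurable_cis[measurable]
  define s where "s = Arg2pi k"
  have s: "0 \<le> s" "s < 2 * pi" and ks: "k = cis s"
    using Arg2pi[of k] k by (auto simp: s_def cis_conv_exp is_Arg_def)
  define h where "h t = f (cis t)" for t
  have h[measurable]: "h \<in> borel_measurable borel" unfolding h_def by measurable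
  have int: "integrable lborel (\<lambda>t. indicator A t *\<^sub>R h t)"
    if "A \<in> sets borel" "A \<subseteq> {0..4 * pi}" for A :: "real set"
  proof (rule Bochner_Integration.integrable_bound[where f="\<lambda>t. indicator {0..4 * pi} t *\<^sub>R B"])
    have "emeasure lborel {0..4 * pi} < \<infinity>" by simp
    then show "integrable lborel (\<lambda>t. indicator {0..4 * pi} t *\<^sub>R B)"
      by (intro integrable_scaleR_left integrable_real_indicator) auto
    have "0 \<le> B" using order_trans[OF norm_ge_zero bound[of 1]] by simp
    show "AE t in lborel. norm (indicator A t *\<^sub>R h t) \<le> norm (indicator {0..4 * pi} t *\<^sub>R B)"
    proof (rule AE_I2)
      fix t
      show "norm (indicator A t *\<^sub>R h t) \<le> norm (indicator {0..4 * pi} t *\<^sub>R B)"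
        using bound[of "cis t"] that(2) \<open>0 \<le> B\<close> by (auto simp: indicator_def h_def)
    qed
  qed (use that in measurable)
  have per: "h (t + 2 * pi) = h t" for t by (simp add: h_def flip: cis_mult)
  have "(\<integral>t. indicator {0..2 * pi} t *\<^sub>R f (k * cis t) \<partial>lborel) = (\<integral>t. indicator {0..2 * pi} t *\<^sub>R h (s + 1 * t) \<partial>lborel)"
    by (simp add: h_def ks cis_mult)
  also have "\<dots> = (\<integral>t. indicator {s..s + 2 * pi} (s + 1 * t) *\<^sub>R h (s + 1 * t) \<partial>lborel)"
    by (intro Bochner_Integration.integral_cong refl) (auto simp: indicator_def)
  also have "\<dots> = (\<integral>t. indicator {s..s + 2 * pi} t *\<^sub>R h t \<partial>lborel)"
    using lborel_integral_real_affine[of 1 "\<lambda>t. indicator {s..s + 2 * pi} t *\<^sub>R h t" s] by simp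
  also have "\<dots> = (\<integral>t. indicator {s..2 * pi} t *\<^sub>R h t + indicator {2 * pi<..s + 2 * pi} t *\<^sub>R h t \<partial>lborel)"
    using s by (intro Bochner_Integration.integral_cong refl) (auto simp: indicator_def)
  also have "\<dots> = (\<integral>t. indicator {s..2 * pi} t *\<^sub>R h t \<partial>lborel) + (\<integral>t. indicator {2 * pi<..s + 2 * pi} t *\<^sub>R h t \<partial>lborel)"
    using s by (intro Bochner_Integration.integral_add int) auto
  also have "(\<integral>t. indicator {2 * pi<..s + 2 * pi} t *\<^sub>R h t \<partial>lborel) =
      (\<integral>t. indicator {2 * pi<..s + 2 * pi} (2 * pi + 1 * t) *\<^sub>R h (2 * pi + 1 * t) \<partial>lborel)"
    using lborel_integral_real_affine[of 1 "\<lambda>t. indicator {2 * pi<..s + 2 * pi} t *\<^sub>R h t" "2 * pi"] by simp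
  also have "\<dots> = (\<integral>t. indicator {0<..s} t *\<^sub>R h t \<partial>lborel)"
    using per by (intro Bochner_Integration.integral_cong refl) (auto simp: indicator_def add.commute)
  also have "(\<integral>t. indicator {s..2 * pi} t *\<^sub>R h t \<partial>lborel) + \<dots> =
      (\<integral>t. indicator {s..2 * pi} t *\<^sub>R h t + indicator {0<..s} t *\<^sub>R h t \<partial>lborel)"
    using s by (intro Bochner_Integration.integral_add[symmetric] int) auto
  also have "\<dots> = (\<integral>t. indicator {0..2 * pi} t *\<^sub>R h t \<partial>lborel)"
  proof (rule integral_cong_AE)
    have "AE t in lborel. t \<noteq> 0 \<and> t \<noteq> s" by (intro AE_conjI AE_lborel_singleton)
    then show "AE t in lborel. indicator {s..2 * pi} t *\<^sub>R h t + indicator {0<..s} t *\<^sub>R h t = indicator {0..2 * pi} t *\<^sub>R h t"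
      by eventually_elim (use s in \<open>auto simp: indicator_def\<close>)
  qed measurable
  finally show ?thesis
    by (simp add: integral_circle_measure h_def)
qed


section \<open>Fourier coefficients of regular sectors\<close>

lemma borel_measurable_cnj [measurable]: "cnj \<in> borel_measurable borel"
  by (intro borel_measurable_continuous_onI continuous_intros)

lemma borel_measurable_sgn_complex [measurable]: "(sgn :: complex \<Rightarrow> complex) \<in> borel_measurable borel"
  unfolding sgn_div_norm[abs_def] by measurable

text \<open>
  For \<open>c = cos (pi / q)\<close> and \<open>w = \<langle>u, a\<rangle> + cnj b\<close>, this is the Fourier coefficient of index \<open>M\<close> of
  the indicator function \<open>l \<mapsto> [u \<in> regular_sector q a b l]\<close>.
\<close>

definition sector_moment :: "real \<Rightarrow> nat \<Rightarrow> complex \<Rightarrow> complex" where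
  "sector_moment c M w = (\<integral>l. (if c * cmod w \<le> Re (w * cnj l) then 1 else 0) * cnj l ^ M \<partial>circle_measure)"

lemma unit_mult_cnj: "cmod l = 1 \<Longrightarrow> l * cnj l = 1"
  by (simp flip: complex_norm_square)

lemma sector_moment_sgn:
  assumes w: "w \<noteq> 0"
  shows "sector_moment c M w = cnj (sgn w) ^ M * sector_moment c M 1"
proof -
  let ?k = "sgn w"
  have k: "cmod ?k = 1" using w by (simp add: norm_sgn)
  have wk: "w * cnj ?k = of_real (cmod w)"
    using w by (simp add: sgn_div_norm scaleR_conv_of_real complex_norm_square[symmetric] power2_eq_square field_simps)
  have "sector_moment c M w = (\<integral>l. (if c * cmod w \<le> Re (w * cnj (?k * l)) then 1 else 0) * cnj (?k * l) ^ M \<partial>circle_measure)"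
    unfolding sector_moment_def
  proof (rule circle_measure_rotate[where B=1, OF _ _ k, symmetric])
    show "(\<lambda>l. (if c * cmod w \<le> Re (w * cnj l) then 1 else 0) * cnj l ^ M) \<in> borel_measurable borel"
      by measurable
  qed (simp add: norm_mult norm_power)
  also have "\<dots> = (\<integral>l. cnj ?k ^ M * ((if c * cmod 1 \<le> Re (1 * cnj l) then 1 else 0) * cnj l ^ M) \<partial>circle_measure)"
  proof (rule Bochner_Integration.integral_cong[OF refl])
    fix l
    have "w * cnj (?k * l) = of_real (cmod w) * cnj l"
      by (simp only: complex_cnj_mult mult.assoc[symmetric] wk)
    then have "Re (w * cnj (?k * l)) = Re (of_real (cmod w) * cnj l)" by (simp only:)
    then have "Re (w * cnj (?k * l)) = cmod w * Re l" by (rule trans) simp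
    moreover have "c * cmod w \<le> cmod w * Re l \<longleftrightarrow> c \<le> Re l" using w by (simp add: mult.commute)
    ultimately show "(if c * cmod w \<le> Re (w * cnj (?k * l)) then 1 else 0) * cnj (?k * l) ^ M =
        cnj ?k ^ M * ((if c * cmod 1 \<le> Re (1 * cnj l) then 1 else 0) * cnj l ^ M)"
      by (simp add: power_mult_distrib)
  qed
  finally show ?thesis by (simp add: sector_moment_def)
qed

text \<open>
  The description of a sector by an inequality between continuous functions makes measurability
  evident; the argument function is not continuous.
\<close>

lemma regular_sector_iff:
  assumes l: "cmod l = 1" and q: "q > 0"
  shows "u \<in> regular_sector q a b l \<longleftrightarrow>
    cos (pi / real q) * cmod (cinner_vec u a + cnj b) \<le> Re ((cinner_vec u a + cnj b) * cnj l)"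
proof -
  let ?w = "cinner_vec u a + cnj b"
  define v where "v = ?w * cnj l"
  have lv: "?w = l * x \<longleftrightarrow> x = v" for x
  proof
    assume "?w = l * x"
    then have "v = (l * cnj l) * x" by (simp add: v_def)
    then show "x = v" by (simp add: unit_mult_cnj[OF l])
  next
    assume "x = v"
    then have "l * x = (l * cnj l) * ?w" by (simp add: v_def)
    then show "?w = l * x" by (simp add: unit_mult_cnj[OF l])
  qed
  have nv: "cmod v = cmod ?w" by (simp add: v_def norm_mult l)
  have "v = 0 \<or> \<bar>Arg v\<bar> \<le> pi / real q \<longleftrightarrow> cos (pi / real q) * cmod v \<le> Re v"
  proof (cases "v = 0")
    case False
    have "Re v = cmod v * cos (Arg v)"
      using rcis_cmod_Arg[of v] by (metis Re_rcis)
    also have "cos (Arg v) = cos \<bar>Arg v\<bar>" by (simp add: abs_if)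
    finally have "cos (pi / real q) * cmod v \<le> Re v \<longleftrightarrow> cos (pi / real q) \<le> cos \<bar>Arg v\<bar>"
      using False by (simp add: mult.commute)
    also have "\<dots> \<longleftrightarrow> \<bar>Arg v\<bar> \<le> pi / real q"
      using q Arg_le_pi[of v] mpi_less_Arg[of v]
      by (intro cos_mono_le_eq) (auto simp: field_simps)
    finally show ?thesis using False by simp
  qed auto
  then show ?thesis
    unfolding regular_sector_def by (auto simp: lv nv v_def[symmetric])
qed

lemma continuous_on_cinner_vec:
  assumes "continuous_on S f" "continuous_on S g"
  shows "continuous_on S (\<lambda>x. cinner_vec (f x) (g x))"
  unfolding cinner_vec_def by (intro continuous_intros assms)

lemma borel_measurable_cinner_vec [measurable]: "(\<lambda>u. cinner_vec u a) \<in> borel_measurable borel"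
  by (intro borel_measurable_continuous_onI continuous_on_cinner_vec continuous_intros)

text \<open>
  Taking real parts, the zero set lies in a real hyperplane if \<open>a \<noteq> 0\<close>; it is empty if \<open>a = 0\<close>.
\<close>

lemma AE_off_hyperplane:
  assumes mu: "mass \<mu>" and nz: "(a, b) \<noteq> (0 :: (complex ^ 'd) \<times> complex)"
  shows "AE u in \<mu>. cinner_vec u a + cnj b \<noteq> 0"
proof -
  let ?N = "{u. cinner_vec u a + cnj b = 0}"
  have "closed ?N"
    by (intro closed_Collect_eq continuous_intros continuous_on_cinner_vec)
  then have borel: "?N \<in> sets borel" by simp
  have "negligible ?N"
  proof (cases "a = 0")
    case True
    then have "?N = {}" using nz by (auto simp: cinner_vec_def zero_prod_def)
    then show ?thesis by simp
  next
    case False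
    have "?N \<subseteq> {u. a \<bullet> u = - Re b}"
    proof
      fix u assume "u \<in> ?N"
      then have "Re (cinner_vec u a) = - Re b"
        by (simp add: complex_eq_iff)
      moreover have "Re (cinner_vec u a) = a \<bullet> u"
        by (simp add: cinner_vec_def inner_vec_def inner_complex_def mult.commute)
      ultimately show "u \<in> {u. a \<bullet> u = - Re b}" by simp
    qed
    then show ?thesis using negligible_hyperplane[of a "- Re b"] False negligible_subset by blast
  qed
  then have "?N \<in> null_sets lborel"
    using borel by (simp add: negligible_iff_null_sets null_sets_completion_iff)
  then have "?N \<in> null_sets \<mu>"
    using mu by (auto simp: mass_def absolutely_continuous_def)
  from AE_not_in[OF this] show ?thesis by simp
qed

text \<open>
  By Fubini the coefficient is the integral over \<open>u\<close> of the coefficients of the individual points,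
  and the latter are known up to the constant \<open>sector_moment c M 1\<close> by rotation invariance.
\<close>

lemma fourier_coeff_regular_sector:
  fixes a :: "complex ^ 'd"
  assumes mu: "mass \<mu>" and nz: "(a, b) \<noteq> 0" and q: "q > 0"
  shows "fourier_coeff (\<lambda>l. measure \<mu> (regular_sector q a b l)) (int M) =
    sector_moment (cos (pi / real q)) M 1 * (\<integral>u. cnj (sgn (cinner_vec u a + cnj b)) ^ M \<partial>\<mu>)"
proof -
  let ?w = "\<lambda>u. cinner_vec u a + cnj b"
  let ?c = "cos (pi / real q)"
  define f where "f u l = (if ?c * cmod (?w u) \<le> Re (?w u * cnj l) then 1 else 0) * cnj l ^ M" for u l
  interpret mu: finite_measure \<mu> using mu by (simp add: mass_def)
  interpret C: finite_measure circle_measure by (rule finite_measure_circle_measure)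
  interpret P: pair_sigma_finite \<mu> circle_measure ..
  interpret PF: finite_measure "\<mu> \<Otimes>\<^sub>M circle_measure"
    by (rule finite_measure_pair_measure) unfold_locales
  have sets_mu[measurable_cong]: "sets \<mu> = sets borel" using mu by (simp add: mass_def)
  have space_mu: "space \<mu> = UNIV" using sets_eq_imp_space_eq[OF sets_mu] by simp
  have id[measurable]: "(\<lambda>l. l) \<in> borel_measurable circle_measure"
    by (rule borel_measurable_circle) simp
  have [measurable]: "snd \<in> borel_measurable (\<mu> \<Otimes>\<^sub>M circle_measure)"
    using measurable_compose[OF measurable_snd id] by simp
  have f_meas: "(\<lambda>z. f (fst z) (snd z)) \<in> borel_measurable (\<mu> \<Otimes>\<^sub>M circle_measure)"
    unfolding f_def by measurable
  have f_int: "integrable (\<mu> \<Otimes>\<^sub>M circle_measure) (case_prod f)"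
    unfolding case_prod_beta
  proof (rule PF.integrable_const_bound[where B=1])
    show "AE z in \<mu> \<Otimes>\<^sub>M circle_measure. cmod (f (fst z) (snd z)) \<le> 1"
      by (rule AE_I2) (auto simp: f_def space_pair_measure space_circle_measure norm_mult norm_power)
  qed (rule f_meas)
  have "fourier_coeff (\<lambda>l. measure \<mu> (regular_sector q a b l)) (int M) = (\<integral>l. (\<integral>u. f u l \<partial>\<mu>) \<partial>circle_measure)"
    unfolding fourier_coeff_def
  proof (rule Bochner_Integration.integral_cong[OF refl])
    fix l assume "l \<in> space circle_measure"
    then have l: "cmod l = 1" by (simp add: space_circle_measure)
    let ?S = "{u. ?c * cmod (?w u) \<le> Re (?w u * cnj l)}"
    have S: "regular_sector q a b l = ?S"
      using regular_sector_iff[OF l q] by blast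
    have Sm: "?S \<in> sets \<mu>" unfolding sets_mu by measurable
    have pw: "l powi - int M = cnj l ^ M"
    proof -
      have "inverse l = cnj l" by (rule inverse_unique) (rule unit_mult_cnj[OF l])
      then show ?thesis by (simp add: power_int_minus power_inverse[symmetric])
    qed
    have "(\<integral>u. f u l \<partial>\<mu>) = (\<integral>u. complex_of_real (indicator ?S u) * cnj l ^ M \<partial>\<mu>)"
      by (intro Bochner_Integration.integral_cong refl) (auto simp: f_def indicator_def)
    also have "\<dots> = (\<integral>u. complex_of_real (indicator ?S u) \<partial>\<mu>) * cnj l ^ M"
      by (rule integral_mult_left_zero)
    also have "(\<integral>u. complex_of_real (indicator ?S u) \<partial>\<mu>) = complex_of_real (measure \<mu> ?S)"
      using Sm by (simp add: integral_complex_of_real space_mu)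
    finally show "complex_of_real (measure \<mu> (regular_sector q a b l)) * l powi - int M = (\<integral>u. f u l \<partial>\<mu>)"
      by (simp add: S pw)
  qed
  also have "\<dots> = (\<integral>u. (\<integral>l. f u l \<partial>circle_measure) \<partial>\<mu>)"
    by (rule P.Fubini_integral[OF f_int])
  also have "\<dots> = (\<integral>u. sector_moment ?c M 1 * cnj (sgn (?w u)) ^ M \<partial>\<mu>)"
  proof (rule integral_cong_AE)
    show "(\<lambda>u. \<integral>l. f u l \<partial>circle_measure) \<in> borel_measurable \<mu>"
      using f_meas by (intro C.borel_measurable_lebesgue_integral) (simp add: case_prod_beta)
    show "AE u in \<mu>. (\<integral>l. f u l \<partial>circle_measure) = sector_moment ?c M 1 * cnj (sgn (?w u)) ^ M"
      using AE_off_hyperplane[OF mu nz[folded zero_prod_def]]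
    proof eventually_elim
      case (elim u)
      then show ?case
        using sector_moment_sgn[of "?w u" ?c M] by (simp add: f_def sector_moment_def mult.commute)
    qed
  qed measurable
  also have "\<dots> = sector_moment ?c M 1 * (\<integral>u. cnj (sgn (?w u)) ^ M \<partial>\<mu>)"
    by (rule integral_mult_right_zero)
  finally show ?thesis .
qed

lemma fourier_coeff_uminus: "fourier_coeff f (- m) = cnj (fourier_coeff f m)"
proof -
  have "fourier_coeff f (- m) = (\<integral>l. cnj (complex_of_real (f l) * l powi (- m)) \<partial>circle_measure)"
    unfolding fourier_coeff_def
  proof (rule Bochner_Integration.integral_cong[OF refl])
    fix l assume "l \<in> space circle_measure"
    then have "inverse l = cnj l"
      by (intro inverse_unique unit_mult_cnj) (simp add: space_circle_measure)
    then have "cnj (l powi (- m)) = l powi m"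
      by (metis complex_cnj_cnj complex_cnj_power_int power_int_inverse power_int_minus)
    then show "complex_of_real (f l) * l powi - (- m) = cnj (complex_of_real (f l) * l powi (- m))"
      by simp
  qed
  also have "\<dots> = cnj (fourier_coeff f m)"
    unfolding fourier_coeff_def by (rule Bochner_Integration.integral_cnj)
  finally show ?thesis .
qed

text \<open>
  Dominated convergence: \<open>sgn\<close> is continuous away from \<open>0\<close>, and the set of \<open>u\<close> with value \<open>0\<close> is null.
\<close>

lemma continuous_on_direction_moment:
  assumes mu: "mass (\<mu> :: (complex ^ 'd) measure)"
  shows "continuous_on (sphere 0 1) (\<lambda>x. \<integral>u. cnj (sgn (cinner_vec u (fst x) + cnj (snd x))) ^ M \<partial>\<mu>)"
  unfolding continuous_on_sequentially
proof (intro allI ballI impI, elim conjE)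
  interpret mu: finite_measure \<mu> using mu by (simp add: mass_def)
  have sets_mu[measurable_cong]: "sets \<mu> = sets borel" using mu by (simp add: mass_def)
  fix X and x :: "(complex ^ 'd) \<times> complex"
  assume x: "x \<in> sphere 0 1" and X: "X \<longlonglongrightarrow> x"
  have "(\<lambda>n. \<integral>u. cnj (sgn (cinner_vec u (fst (X n)) + cnj (snd (X n)))) ^ M \<partial>\<mu>)
     \<longlonglongrightarrow> (\<integral>u. cnj (sgn (cinner_vec u (fst x) + cnj (snd x))) ^ M \<partial>\<mu>)"
  proof (rule integral_dominated_convergence[where w="\<lambda>_. 1"])
    have "(fst x, snd x) \<noteq> 0" using x by auto
    from AE_off_hyperplane[OF mu this]
    show "AE u in \<mu>. (\<lambda>n. cnj (sgn (cinner_vec u (fst (X n)) + cnj (snd (X n)))) ^ M)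
       \<longlonglongrightarrow> cnj (sgn (cinner_vec u (fst x) + cnj (snd x))) ^ M"
    proof eventually_elim
      case (elim u)
      then show ?case
        unfolding cinner_vec_def by (intro tendsto_intros X) auto
    qed
    show "AE u in \<mu>. norm (cnj (sgn (cinner_vec u (fst (X n)) + cnj (snd (X n)))) ^ M) \<le> 1" for n
      by (rule AE_I2) (auto simp: norm_power norm_sgn power_le_one)
    show "integrable \<mu> (\<lambda>_. 1 :: real)" by simp
  qed measurable
  then show "((\<lambda>x. \<integral>u. cnj (sgn (cinner_vec u (fst x) + cnj (snd x))) ^ M \<partial>\<mu>) \<circ> X)
    \<longlonglongrightarrow> (\<integral>u. cnj (sgn (cinner_vec u (fst x) + cnj (snd x))) ^ M \<partial>\<mu>)"
    by (simp add: o_def)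
qed

theorem theorem1p1:
  fixes q :: nat and \<mu> :: "nat \<Rightarrow> (complex ^ 'd) measure" and m :: "nat \<Rightarrow> int"
  assumes "q \<ge> 2"
    and "\<And>j. j \<in> {1..CARD('d)} \<Longrightarrow> mass (\<mu> j)"
    and "\<And>j. j \<in> {1..CARD('d)} \<Longrightarrow> m j > 0"
  shows "\<exists>H a b. complex_hyperplane H \<and> unit_equation a b H \<and>
    (\<forall>j\<in>{1..CARD('d)}.
       fourier_coeff (\<lambda>l. measure (\<mu> j) (regular_sector q a b l)) (m j) = 0 \<and>
       fourier_coeff (\<lambda>l. measure (\<mu> j) (regular_sector q a b l)) (- m j) = 0)"
proof -
  have "\<exists>\<beta>. bij_betw \<beta> (UNIV :: 'd set) {1..CARD('d)}"
    by (rule finite_same_card_bij) auto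
  then obtain \<beta> where \<beta>: "bij_betw \<beta> (UNIV :: 'd set) {1..CARD('d)}" by blast
  have \<beta>_in: "\<beta> i \<in> {1..CARD('d)}" for i using \<beta> by (auto simp: bij_betw_def)
  define M where "M i = nat (m (\<beta> i))" for i
  have M: "M i > 0" "m (\<beta> i) = int (M i)" for i
    using assms(3)[OF \<beta>_in[of i]] by (auto simp: M_def)
  note mass = assms(2)[OF \<beta>_in]
  define F where "F i x = (\<integral>u. cnj (sgn (cinner_vec u (fst x) + cnj (snd x))) ^ M i \<partial>\<mu> (\<beta> i))"
    for i and x :: "(complex ^ 'd) \<times> complex"
  define \<kappa> where "\<kappa> i = sector_moment (cos (pi / real q)) (M i) 1" for i
  \<comment> \<open>Indices whose coefficients vanish for every hyperplane.  They are discarded, because at a point with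
    \<open>a = 0\<close> only a function of another index is certain to be nonzero.\<close>
  define trivial where "trivial i \<longleftrightarrow> \<kappa> i = 0 \<or> measure (\<mu> (\<beta> i)) UNIV = 0" for i
  have coeff: "fourier_coeff (\<lambda>l. measure (\<mu> (\<beta> i)) (regular_sector q a b l)) (m (\<beta> i)) = \<kappa> i * F i (a, b)"
    if "(a, b) \<noteq> 0" for i a b
    using fourier_coeff_regular_sector[OF mass that, of q i "M i"] assms(1)
    by (simp add: M(2) \<kappa>_def F_def)
  have space: "space (\<mu> (\<beta> i)) = UNIV" for i
    using mass[of i] sets_eq_imp_space_eq[of "\<mu> (\<beta> i)" borel] by (simp add: mass_def)
  have F_null: "F i x = 0" if "measure (\<mu> (\<beta> i)) UNIV = 0" for i x
  proof -
    interpret finite_measure "\<mu> (\<beta> i)" using mass[of i] by (simp add: mass_def)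
    have "UNIV \<in> null_sets (\<mu> (\<beta> i))"
      using that mass[of i] by (auto simp: null_sets_def emeasure_eq_measure mass_def)
    then have "AE u in \<mu> (\<beta> i). False"
      using AE_not_in by fastforce
    then show ?thesis unfolding F_def by (intro integral_eq_zero_AE) auto
  qed
  define G where "G i x = (if trivial i then 0 else F i x)" for i x
  obtain a b where ab: "norm (a, b) = 1" "a \<noteq> 0" and G0: "\<And>i. G i (a, b) = 0"
  proof (cases "\<forall>i. trivial i")
    case True
    \<comment> \<open>Every hyperplane has vanishing coefficients.\<close>
    obtain i :: 'd where True by blast
    have "norm (axis i 1 :: complex ^ 'd, 0 :: complex) = 1" by (simp add: norm_Pair norm_eq_sqrt_inner[of "axis i 1"] inner_axis_axis inner_complex_def)
    moreover have "(axis i 1 :: complex ^ 'd) \<noteq> 0" by (simp add: axis_eq_0_iff)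
    ultimately show ?thesis using True that[of "axis i 1" 0] by (simp add: G_def)
  next
    case False
    then obtain i where i: "\<not> trivial i" by blast
    have "\<exists>x\<in>sphere 0 1. \<forall>i. G i x = 0"
    proof (rule circle_Borsuk_Ulam[OF _ _ M(1)])
      show "continuous_on (sphere 0 1) (G i)" for i
        unfolding G_def F_def using continuous_on_direction_moment[OF mass]
        by (cases "trivial i") auto
      show "G i (circle_act l x) = l ^ M i * G i x" if "cmod l = 1" for i l x
      proof -
        have "cinner_vec u (fst (circle_act l x)) + cnj (snd (circle_act l x)) =
            cnj l * (cinner_vec u (fst x) + cnj (snd x))" for u
          by (simp add: cinner_vec_def circle_act_def sum_distrib_left distrib_left mult_ac)
        moreover have "sgn (cnj l) = cnj l" using that by (simp add: sgn_div_norm)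
        ultimately have "F i (circle_act l x) = (\<integral>u. l ^ M i * cnj (sgn (cinner_vec u (fst x) + cnj (snd x))) ^ M i \<partial>\<mu> (\<beta> i))"
          by (simp only: F_def sgn_mult complex_cnj_mult complex_cnj_cnj power_mult_distrib)
        then show ?thesis by (simp add: G_def F_def)
      qed
    qed
    then obtain x where x: "norm x = 1" "\<And>i. G i x = 0" by auto
    obtain a b where ab: "x = (a, b)" by (cases x)
    have "a \<noteq> 0"
    proof
      assume "a = 0"
      then have b: "cmod b = 1" using x(1) ab by (simp add: norm_Pair)
      have "F i x = cnj (sgn (cnj b)) ^ M i * of_real (measure (\<mu> (\<beta> i)) UNIV)"
        using \<open>a = 0\<close> by (simp add: F_def ab cinner_vec_def space scaleR_conv_of_real mult.commute)
      moreover have "sgn (cnj b) \<noteq> 0" using b by (auto simp: sgn_zero_iff)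
      ultimately have "F i x \<noteq> 0" using i by (simp add: trivial_def)
      then show False using x(2)[of i] i by (simp add: G_def)
    qed
    then show ?thesis using x ab that by blast
  qed
  have nz: "(a, b) \<noteq> 0" using ab by auto
  have zero: "fourier_coeff (\<lambda>l. measure (\<mu> (\<beta> i)) (regular_sector q a b l)) (m (\<beta> i)) = 0" for i
    using G0[of i] F_null[of i] coeff[OF nz, of i] by (auto simp: G_def trivial_def split: if_splits)
  have "fourier_coeff (\<lambda>l. measure (\<mu> j) (regular_sector q a b l)) (m j) = 0 \<and>
       fourier_coeff (\<lambda>l. measure (\<mu> j) (regular_sector q a b l)) (- m j) = 0" if j: "j \<in> {1..CARD('d)}" for j
  proof -
    obtain i where "j = \<beta> i" using j \<beta> by (metis bij_betw_imp_surj_on imageE)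
    then show ?thesis using zero[of i] by (simp add: fourier_coeff_uminus)
  qed
  moreover have "unit_equation a b {u. cinner_vec u a + cnj b = 0}"
    using ab by (simp add: unit_equation_def norm_Pair)
  ultimately show ?thesis
    using complex_hyperplane_equation[OF ab(2), of "cnj b"] by blast
qed

end
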